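(* Suppose that $0<\tau_i<2/L_i$ for all $i\in\{1,\dots,N\}$, $0<\beta\le0.5/\max_i\tau_i$, and $\sum_{k=1}^\infty\varepsilon_k<\infty$. Then for the sequences generated by the inexact recursion (D-iPGM) described in the context, as $K\to\infty$: 1. (running-average first-order optimality residual) $\displaystyle \frac1{K+1}\sum_{k=0}^K\mathrm{dist}^2(\mathbf 0,\mathcal J(\tilde{\mathbf u}^k))=O\Big(\frac1{K+1}\Big)$; 2. (running-best first-order optimality residual) $\displaystyle \min_{0\le k\le K}\{\mathrm{dist}^2(\mathbf 0,\mathcal J(\tilde{\mathbf u}^k))\}=o\Big(\frac1{K+1}\Big)$. Let $\mathbf X^K=\frac1K\sum_{k=0}^{K-1}\tilde{\mathbf x}^k$ and $\boldsymbol\Lambda^K=\frac1K\sum_{k=0}^{K-1}\tilde{\boldsymbol\alpha}^k$. If, furthermore, $0<\tau_i<1/L_i$ for all $i$, then: 1. (primal-dual gap) for every $(\mathbf x,\boldsymbol\alpha)\in\mathcal M$, $L(\mathbf X^K,\boldsymbol\alpha)-L(\mathbf x,\boldsymbol\Lambda^K)\le O(1/K)$, i.e. there is a constant $C<\infty$ (depending on $(\mathbf x,\boldsymbol\alpha)$ but not on $K$) with $L(\mathbf X^K,\boldsymbol\alpha)-L(\mathbf x,\boldsymbol\Lambda^K)\le C/K$ for all $K\ge1$; 2. (primal optimality gap) $|\phi(\mathbf X^K)-\phi(\mathbf x^* )|=O(1/K)$, where $\mathbf x^*$ is any optimal solution of $\min_{\mathbf x}\phi(\mathbf x)$ subject to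 $\sqrt{\mathbf I-\mathbf W}\,\mathbf x=\mathbf 0$; 3. (consensus error) $\|\sqrt{\mathbf I-\mathbf W}\,\mathbf X^K\|=O(1/K)$.
   Context: Problem. Let $N,n\ge1$ and consider $\min_{\mathrm x\in\mathbb R^n}\sum_{i=1}^N (f_i(\mathrm x)+g_i(\mathrm x))$, where each $f_i:\mathbb R^n\to\mathbb R$ is convex and $L_i$-smooth (differentiable with $L_i$-Lipschitz gradient, $L_i>0$), and each $g_i:\mathbb R^n\to\mathbb R\cup\{\infty\}$ is proper, closed and convex (not necessarily smooth). An optimal solution is assumed to exist. For $\mathbf x=\mathrm{col}\{\mathrm x_1,\dots,\mathrm x_N\}\in\mathbb R^{Nn}$ (stacked vector) put $F(\mathbf x)=\sum_i f_i(\mathrm x_i)$, $G(\mathbf x)=\sum_i g_i(\mathrm x_i)$, $\phi=F+G$. Network. $\mathcal G=(\mathcal V,\mathcal E)$ is an undirected connected graph on $N$ vertices. $W=[W_{ij}]\in\mathbb R^{N\times N}$ is symmetric and doubly stochastic, the null space of $\mathbf I-W$ is $\mathrm{Span}(\mathbf 1)$, $W_{ij}=W_{ji}=0$ if $(i,j)\notin\mathcal E$ and $i\ne j$, and $W_{ij}>0$ otherwise. Let $\mathbf W=W\otimes\mathbf I_n$ and $\mathbf V=\sqrt{\mathbf I-\mathbf W}$ (positive semidefinite square root). The problem is equivalent to $\min_{\mathbf x}\phi(\mathbf x)$ subject to $\mathbf V\mathbf x=\mathbf 0$. Saddle points and KKT mapping. $\mathcal M=\mathbb R^{Nn}\times\mathbb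 R^{Nn}$, $L(\mathbf x,\boldsymbol\alpha)=F(\mathbf x)+G(\mathbf x)-\langle\boldsymbol\alpha,\mathbf V\mathbf x\rangle$, and $\mathcal M^*\subseteq\mathcal M$ is the set of $(\mathbf x^*,\boldsymbol\alpha^* )$ with $L(\mathbf x^*,\boldsymbol\alpha)\le L(\mathbf x^*,\boldsymbol\alpha^* )\le L(\mathbf x,\boldsymbol\alpha^* )$ for all $(\mathbf x,\boldsymbol\alpha)\in\mathcal M$. Strong duality is assumed, so that $\mathcal M^*\neq\emptyset$. The KKT mapping is the set-valued map $$\mathcal J(\mathbf u)=\begin{pmatrix}\partial G(\mathbf x)+\nabla F(\mathbf x)-\mathbf V\boldsymbol\alpha\\ \mathbf V\mathbf x\end{pmatrix},\qquad \mathbf u=\mathrm{col}\{\mathbf x,\boldsymbol\alpha\},$$ and $\mathrm{dist}(\mathbf 0,\mathcal J(\mathbf u))$ is the Euclidean distance from $\mathbf 0$ to this set. Norms. For a symmetric positive definite matrix $\mathcal H$, $\|\mathbf z\|_{\mathcal H}^2=\langle\mathbf z,\mathcal H\mathbf z\rangle$ and $\mathrm{prox}_\theta^{\mathcal H}(\mathbf x)=\arg\min_{\mathbf y}\{\theta(\mathbf y)+\tfrac12\|\mathbf y-\mathbf x\|_{\mathcal H}^2\}$. Algorithm (D-iPGM). Let $\tau_i>0$, $\beta>0$, $\Gamma=\mathrm{diag}\{\tau_1\mathbf I_n,\dots,\tau_N\mathbf I_n\}$, $\mathbf M=\begin{pmatrix}\mathbf I&\Gamma\mathbf V\\ \mathbf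 0&\mathbf I\end{pmatrix}$, and let $\{\varepsilon_k\}$ be a sequence of nonnegative numbers. Starting from any $\mathbf x^0\in\mathbb R^{Nn}$ and $\boldsymbol\alpha^0=\mathbf 0$, for $k\ge0$, $$\tilde{\mathbf x}^k=\mathrm{prox}_G^{\Gamma^{-1}}\big(\mathbf x^k-\Gamma(\nabla F(\mathbf x^k)-\mathbf V\boldsymbol\alpha^k-\mathbf d^k)\big),\quad \tilde{\boldsymbol\alpha}^k=\boldsymbol\alpha^k-\beta\mathbf V\tilde{\mathbf x}^k,\quad \mathbf u^{k+1}=\mathbf u^k-\mathbf M(\mathbf u^k-\tilde{\mathbf u}^k),$$ where $\mathbf u^k=\mathrm{col}\{\mathbf x^k,\boldsymbol\alpha^k\}$, $\tilde{\mathbf u}^k=\mathrm{col}\{\tilde{\mathbf x}^k,\tilde{\boldsymbol\alpha}^k\}$, and $\mathbf d^k=\mathrm{col}\{\mathrm d_1^k,\dots,\mathrm d_N^k\}$ is an arbitrary error vector (the residual of the inexactly solved proximal subproblems) with $\|\mathrm d_i^k\|\le\varepsilon_k$ for all $i$. *)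

theory Defs
  imports "HOL-Analysis.Analysis" "HOL-Library.Landau_Symbols"
begin

text \<open>
  The agents are the elements of a finite type \<open>'a\<close> (so \<open>N = CARD('a)\<close>), and
  \<open>real ^ 'n ^ 'a\<close> is the space of stacked vectors: \<open>x $ i\<close> is the block of agent \<open>i\<close>, and
  inner product and norm are the Euclidean ones of \<open>\<real>\<^sup>N\<^sup>n\<close>.  Matrices acting on stacked vectors
  are represented by the corresponding operators.
\<close>

definition grad :: "('v::real_inner \<Rightarrow> real) \<Rightarrow> 'v \<Rightarrow> 'v" where
  "grad f x = (THE D. GDERIV f x :> D)"

definition L_smooth :: "real \<Rightarrow> ('v::real_inner \<Rightarrow> real) \<Rightarrow> bool" where
  "L_smooth L f \<longleftrightarrow> (\<forall>x. f differentiable (at x)) \<and> L-lipschitz_on UNIV (grad f)"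

definition epi :: "('v \<Rightarrow> ereal) \<Rightarrow> ('v \<times> real) set" where
  "epi h = {(x, t). h x \<le> ereal t}"

definition proper_closed_convex :: "('v::real_normed_vector \<Rightarrow> ereal) \<Rightarrow> bool" where
  "proper_closed_convex h \<longleftrightarrow>
     (\<forall>x. h x \<noteq> -\<infinity>) \<and> (\<exists>x. h x \<noteq> \<infinity>) \<and> closed (epi h) \<and> convex (epi h)"

definition subdiff :: "('v::real_inner \<Rightarrow> ereal) \<Rightarrow> 'v \<Rightarrow> 'v set" where
  "subdiff h x = {s. \<forall>y. h x + ereal (s \<bullet> (y - x)) \<le> h y}"

text \<open>\<open>p\<close> is the (unique) point \<open>prox\<^sub>h\<^sup>H(x)\<close>; \<open>\<parallel>z\<parallel>\<^sub>H\<^sup>2 = \<langle>z, H z\<rangle>\<close>.\<close>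
definition is_prox :: "('v \<Rightarrow> 'v) \<Rightarrow> ('v::real_inner \<Rightarrow> ereal) \<Rightarrow> 'v \<Rightarrow> 'v \<Rightarrow> bool" where
  "is_prox H h x p \<longleftrightarrow>
     is_arg_min (\<lambda>y. h y + ereal (1 / 2 * ((y - x) \<bullet> H (y - x)))) (\<lambda>_. True) p"

text \<open>\<open>B\<close> is the symmetric positive semidefinite square root of \<open>A\<close>.\<close>
definition psd_sqrt :: "('v::real_inner \<Rightarrow> 'v) \<Rightarrow> ('v \<Rightarrow> 'v) \<Rightarrow> bool" where
  "psd_sqrt A B \<longleftrightarrow>
     linear B \<and> (\<forall>x y. B x \<bullet> y = x \<bullet> B y) \<and> (\<forall>x. 0 \<le> x \<bullet> B x) \<and> B \<circ> B = A"

definition mixing_matrix :: "('a \<times> 'a) set \<Rightarrow> real ^ 'a ^ 'a \<Rightarrow> bool" where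
  "mixing_matrix E W \<longleftrightarrow>
     transpose W = W \<and>
     (\<forall>i j. 0 \<le> W $ i $ j) \<and> (\<forall>i. (\<Sum>j\<in>UNIV. W $ i $ j) = 1) \<and> (\<forall>j. (\<Sum>i\<in>UNIV. W $ i $ j) = 1) \<and>
     {v. (mat 1 - W) *v v = 0} = span {\<chi> i. 1} \<and>
     (\<forall>i j. if (i, j) \<notin> E \<and> i \<noteq> j then W $ i $ j = 0 else 0 < W $ i $ j)"

text \<open>The operator \<open>W \<otimes> I\<^sub>n\<close>.\<close>
definition kron_id :: "real ^ 'a ^ 'a \<Rightarrow> real ^ 'n ^ 'a \<Rightarrow> real ^ 'n ^ 'a" where
  "kron_id W x = (\<chi> i. \<Sum>j\<in>UNIV. W $ i $ j *\<^sub>R x $ j)"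

text \<open>The operator \<open>diag {c\<^sub>1 I\<^sub>n, \<dots>, c\<^sub>N I\<^sub>n}\<close>.\<close>
definition block_diag :: "('a \<Rightarrow> real) \<Rightarrow> real ^ 'n ^ 'a \<Rightarrow> real ^ 'n ^ 'a" where
  "block_diag c x = (\<chi> i. c i *\<^sub>R x $ i)"

text \<open>\<open>F\<close> and \<open>G\<close> are \<open>stack_sum f\<close> and \<open>stack_sum g\<close>.\<close>
definition stack_sum :: "('a \<Rightarrow> 'v \<Rightarrow> 'b::comm_monoid_add) \<Rightarrow> 'v ^ 'a \<Rightarrow> 'b" where
  "stack_sum h x = (\<Sum>i\<in>UNIV. h i (x $ i))"

definition objective ::
  "('a \<Rightarrow> real ^ 'n \<Rightarrow> real) \<Rightarrow> ('a \<Rightarrow> real ^ 'n \<Rightarrow> ereal) \<Rightarrow> real ^ 'n ^ 'a \<Rightarrow> ereal" where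
  "objective f g x = ereal (stack_sum f x) + stack_sum g x"

definition lagrangian ::
  "('a \<Rightarrow> real ^ 'n \<Rightarrow> real) \<Rightarrow> ('a \<Rightarrow> real ^ 'n \<Rightarrow> ereal) \<Rightarrow> (real ^ 'n ^ 'a \<Rightarrow> real ^ 'n ^ 'a) \<Rightarrow>
   real ^ 'n ^ 'a \<Rightarrow> real ^ 'n ^ 'a \<Rightarrow> ereal" where
  "lagrangian f g V x \<alpha> = ereal (stack_sum f x) + stack_sum g x - ereal (\<alpha> \<bullet> V x)"

definition saddle_points ::
  "('a \<Rightarrow> real ^ 'n \<Rightarrow> real) \<Rightarrow> ('a \<Rightarrow> real ^ 'n \<Rightarrow> ereal) \<Rightarrow> (real ^ 'n ^ 'a \<Rightarrow> real ^ 'n ^ 'a) \<Rightarrow>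
   ((real ^ 'n ^ 'a) \<times> (real ^ 'n ^ 'a)) set" where
  "saddle_points f g V =
     {(xs, \<alpha>s). \<forall>x \<alpha>. lagrangian f g V xs \<alpha> \<le> lagrangian f g V xs \<alpha>s \<and>
                       lagrangian f g V xs \<alpha>s \<le> lagrangian f g V x \<alpha>s}"

definition kkt ::
  "('a \<Rightarrow> real ^ 'n \<Rightarrow> real) \<Rightarrow> ('a \<Rightarrow> real ^ 'n \<Rightarrow> ereal) \<Rightarrow> (real ^ 'n ^ 'a \<Rightarrow> real ^ 'n ^ 'a) \<Rightarrow>
   (real ^ 'n ^ 'a) \<times> (real ^ 'n ^ 'a) \<Rightarrow> ((real ^ 'n ^ 'a) \<times> (real ^ 'n ^ 'a)) set" where
  "kkt f g V = (\<lambda>(x, \<alpha>).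
     (\<lambda>s. (s + grad (stack_sum f) x - V \<alpha>, V x)) ` subdiff (stack_sum g) x)"

text \<open>
  The distance from \<open>0\<close> to \<open>kkt f g V u\<close>.  The library sets \<open>infdist 0 {} = 0\<close>, but the set is
  nonempty whenever the first component of \<open>u\<close> is a proximal point of \<open>stack_sum g\<close>, in
  particular at every iterate \<open>ut k\<close> below.
\<close>
definition kkt_dist ::
  "('a \<Rightarrow> real ^ 'n \<Rightarrow> real) \<Rightarrow> ('a \<Rightarrow> real ^ 'n \<Rightarrow> ereal) \<Rightarrow> (real ^ 'n ^ 'a \<Rightarrow> real ^ 'n ^ 'a) \<Rightarrow>
   (real ^ 'n ^ 'a) \<times> (real ^ 'n ^ 'a) \<Rightarrow> real" where
  "kkt_dist f g V u = infdist 0 (kkt f g V u)"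

text \<open>The block operator with rows \<open>(I, \<Gamma> V)\<close> and \<open>(0, I)\<close>, where \<open>\<Gamma> = block_diag \<tau>\<close>.\<close>
definition correction ::
  "('a \<Rightarrow> real) \<Rightarrow> (real ^ 'n ^ 'a \<Rightarrow> real ^ 'n ^ 'a) \<Rightarrow>
   (real ^ 'n ^ 'a) \<times> (real ^ 'n ^ 'a) \<Rightarrow> (real ^ 'n ^ 'a) \<times> (real ^ 'n ^ 'a)" where
  "correction \<tau> V = (\<lambda>(p, q). (p + block_diag \<tau> (V q), q))"

text \<open>
  \<open>u k = (x\<^sup>k, \<alpha>\<^sup>k)\<close> and \<open>ut k = (x~\<^sup>k, \<alpha>~\<^sup>k)\<close> form a trajectory of D-iPGM with error vectors \<open>d k\<close>.
\<close>
definition D_iPGM ::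
  "('a \<Rightarrow> real ^ 'n \<Rightarrow> real) \<Rightarrow> ('a \<Rightarrow> real ^ 'n \<Rightarrow> ereal) \<Rightarrow> (real ^ 'n ^ 'a \<Rightarrow> real ^ 'n ^ 'a) \<Rightarrow>
   ('a \<Rightarrow> real) \<Rightarrow> real \<Rightarrow> (nat \<Rightarrow> real ^ 'n ^ 'a) \<Rightarrow>
   (nat \<Rightarrow> (real ^ 'n ^ 'a) \<times> (real ^ 'n ^ 'a)) \<Rightarrow> (nat \<Rightarrow> (real ^ 'n ^ 'a) \<times> (real ^ 'n ^ 'a)) \<Rightarrow> bool" where
  "D_iPGM f g V \<tau> \<beta> d u ut \<longleftrightarrow>
     snd (u 0) = 0 \<and>
     (\<forall>k. is_prox (block_diag (\<lambda>i. inverse (\<tau> i))) (stack_sum g)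
             (fst (u k) - block_diag \<tau> (grad (stack_sum f) (fst (u k)) - V (snd (u k)) - d k))
             (fst (ut k)) \<and>
          snd (ut k) = snd (u k) - \<beta> *\<^sub>R V (fst (ut k)) \<and>
          u (Suc k) = u k - correction \<tau> V (u k - ut k))"

text \<open>The average of the first \<open>K\<close> members of a sequence.\<close>
definition average :: "(nat \<Rightarrow> 'v::real_vector) \<Rightarrow> nat \<Rightarrow> 'v" where
  "average z K = (1 / real K) *\<^sub>R (\<Sum>k<K. z k)"

end

theory Submission
  imports Defs
begin

text \<open>
  Let \<open>p = x - x~\<close>, \<open>q = \<alpha> - \<alpha>~\<close> and \<open>\<Phi> k z w = \<parallel>x\<^sup>k - z\<parallel>\<^sup>2 + \<parallel>\<alpha>\<^sup>k - w\<parallel>\<^sup>2 / \<beta>\<close>, the first norm being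
  weighted by \<open>\<Gamma>\<close> inverted.  The change of \<open>\<Phi>\<close> in one iteration is computed exactly.  At a
  saddle point, monotonicity of the subdifferential of \<open>G\<close> and cocoercivity of the gradient of \<open>F\<close>
  show that \<open>\<Phi>\<close> decreases by a multiple of \<open>\<parallel>p\<parallel>\<^sup>2 + \<parallel>q\<parallel>\<^sup>2\<close>, up to a summable error.  The
  coefficient of \<open>\<parallel>q\<parallel>\<^sup>2\<close> is positive although \<open>2 \<beta> max \<tau> = 1\<close> is allowed: the diagonal of \<open>W\<close>
  is positive, hence \<open>\<parallel>V q\<parallel>\<^sup>2 \<le> (2 - \<delta>) \<parallel>q\<parallel>\<^sup>2\<close> for some \<open>\<delta> > 0\<close>.  The KKT residual is at most a multiple of
  \<open>\<parallel>p\<parallel> + \<parallel>q\<parallel> + \<parallel>d\<parallel>\<close>, so its squares are summable.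

  For small step sizes, the descent lemma bounds twice the primal-dual gap at \<open>(z, w)\<close> by the decrease
  of \<open>\<Phi> k z w\<close> plus a summable error; telescoping and Jensen's inequality give the averaged gap.
  The consensus error is \<open>O(1 / K)\<close> because \<open>\<beta> V X\<^sup>K = (\<alpha>\<^sup>0 - \<alpha>\<^sup>K) / K\<close> and \<open>\<alpha>\<^sup>K\<close> is bounded.
\<close>

subsection \<open>Gradients of smooth convex functions\<close>

lemma grad_eqI: "GDERIV f x :> D \<Longrightarrow> grad f x = D"
proof -
  assume D: "GDERIV f x :> D"
  have "D' = D" if "GDERIV f x :> D'" for D'
    using has_derivative_unique[OF that[unfolded gderiv_def] D[unfolded gderiv_def]]
    by (metis inner_commute vector_eq_rdot)
  with D show ?thesis unfolding grad_def by blast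
qed

lemma GDERIV_grad:
  fixes f :: "'v::euclidean_space \<Rightarrow> real"
  assumes "f differentiable (at x)"
  shows "GDERIV f x :> grad f x"
proof -
  obtain f' where f': "(f has_derivative f') (at x)"
    using assms by (auto simp: differentiable_def)
  then have "linear f'"
    by (rule has_derivative_linear)
  then have "f' = (\<lambda>h. h \<bullet> adjoint f' 1)"
    using adjoint_works[of f' _ "1::real"] by auto
  with f' have "GDERIV f x :> adjoint f' 1"
    unfolding gderiv_def by metis
  then show ?thesis
    using grad_eqI by metis
qed

lemma GDERIV_line:
  assumes "GDERIV f (x + t *\<^sub>R v) :> D"
  shows "((\<lambda>s. f (x + s *\<^sub>R v)) has_real_derivative (D \<bullet> v)) (at t)"
proof -
  have "((\<lambda>s. x + s *\<^sub>R v) has_derivative (\<lambda>s. s *\<^sub>R v)) (at t)"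
    by (auto intro!: derivative_eq_intros)
  from has_derivative_compose[OF this assms[unfolded gderiv_def]]
  show ?thesis
    by (simp add: has_field_derivative_def inner_commute mult_commute_abs)
qed

lemma convex_ge_tangent:
  fixes f :: "'v::euclidean_space \<Rightarrow> real"
  assumes "convex_on UNIV f" "f differentiable (at x)"
  shows "f x + grad f x \<bullet> (y - x) \<le> f y"
proof -
  have "convex_on UNIV (\<lambda>s. f (x + s *\<^sub>R (y - x)))"
  proof (rule convex_onI)
    fix t a b :: real assume "0 < t" "t < 1"
    moreover have "x + ((1 - t) *\<^sub>R a + t *\<^sub>R b) *\<^sub>R (y - x) =
      (1 - t) *\<^sub>R (x + a *\<^sub>R (y - x)) + t *\<^sub>R (x + b *\<^sub>R (y - x))"
      by (simp add: algebra_simps)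
    ultimately show "f (x + ((1 - t) *\<^sub>R a + t *\<^sub>R b) *\<^sub>R (y - x))
        \<le> (1 - t) * f (x + a *\<^sub>R (y - x)) + t * f (x + b *\<^sub>R (y - x))"
      using convex_onD[OF assms(1), of t "x + a *\<^sub>R (y - x)" "x + b *\<^sub>R (y - x)"] by simp
  qed simp
  moreover have "((\<lambda>s. f (x + s *\<^sub>R (y - x))) has_real_derivative (grad f x \<bullet> (y - x))) (at 0)"
    using GDERIV_grad[OF assms(2)] by (intro GDERIV_line) simp
  ultimately show ?thesis
    using convex_on_imp_above_tangent[of UNIV "\<lambda>s. f (x + s *\<^sub>R (y - x))" 0 1] by fastforce
qed

lemma L_smooth_le_quadratic:
  fixes f :: "'v::euclidean_space \<Rightarrow> real"
  assumes "L_smooth L f"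
  shows "f y \<le> f x + grad f x \<bullet> (y - x) + L / 2 * (norm (y - x))\<^sup>2"
proof -
  define v where "v = y - x"
  define \<psi> where "\<psi> = (\<lambda>s. f (x + s *\<^sub>R v) - s * (grad f x \<bullet> v) - L / 2 * s\<^sup>2 * (norm v)\<^sup>2)"
  have lip: "norm (grad f a - grad f b) \<le> L * norm (a - b)" for a b
    using assms by (auto simp: L_smooth_def lipschitz_on_def dist_norm)
  have "\<psi> 1 \<le> \<psi> 0"
  proof (rule DERIV_nonpos_imp_nonincreasing, simp)
    fix t :: real assume t: "0 \<le> t" "t \<le> 1"
    have 1: "(\<psi> has_real_derivative (grad f (x + t *\<^sub>R v) \<bullet> v - grad f x \<bullet> v - L * t * (norm v)\<^sup>2)) (at t)"
      unfolding \<psi>_def using assms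
      by (auto intro!: derivative_eq_intros GDERIV_line GDERIV_grad simp: L_smooth_def)
    have "(grad f (x + t *\<^sub>R v) - grad f x) \<bullet> v \<le> norm (grad f (x + t *\<^sub>R v) - grad f x) * norm v"
      by (rule norm_cauchy_schwarz)
    also have "\<dots> \<le> (L * norm (t *\<^sub>R v)) * norm v"
      using lip[of "x + t *\<^sub>R v" x] by (intro mult_right_mono) auto
    finally have "grad f (x + t *\<^sub>R v) \<bullet> v - grad f x \<bullet> v - L * t * (norm v)\<^sup>2 \<le> 0"
      using t by (simp add: inner_diff_left power2_eq_square)
    with 1 show "\<exists>y. (\<psi> has_real_derivative y) (at t) \<and> y \<le> 0"
      by blast
  qed
  then show ?thesis
    by (simp add: \<psi>_def v_def)
qed

lemma cocoercive_aux:
  fixes f :: "'v::euclidean_space \<Rightarrow> real"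
  assumes "convex_on UNIV f" "L_smooth L f" "0 < L"
  shows "f x + grad f x \<bullet> (y - x) + 1 / (2 * L) * (norm (grad f y - grad f x))\<^sup>2 \<le> f y"
proof -
  define r where "r = grad f y - grad f x"
  define z where "z = y - (1 / L) *\<^sub>R r"
  have "f x + grad f x \<bullet> (z - x) \<le> f z"
    using assms by (intro convex_ge_tangent) (auto simp: L_smooth_def)
  also have "f z \<le> f y + grad f y \<bullet> (z - y) + L / 2 * (norm (z - y))\<^sup>2"
    by (rule L_smooth_le_quadratic) fact
  finally have "f x + grad f x \<bullet> (z - x)
      \<le> f y + grad f y \<bullet> (z - y) + L / 2 * (norm (z - y))\<^sup>2" .
  moreover have "grad f x \<bullet> (z - x) = grad f x \<bullet> (y - x) - (1 / L) * (grad f x \<bullet> r)"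
    by (simp add: z_def inner_diff_right)
  moreover have "grad f y \<bullet> (z - y) = - ((1 / L) * (grad f y \<bullet> r))"
    by (simp add: z_def)
  moreover have "L / 2 * (norm (z - y))\<^sup>2 = 1 / (2 * L) * (norm r)\<^sup>2"
    using \<open>0 < L\<close> by (simp add: z_def power_divide power2_eq_square)
  ultimately have "f x + grad f x \<bullet> (y - x) - (1 / L) * (grad f x \<bullet> r)
      \<le> f y - (1 / L) * (grad f y \<bullet> r) + 1 / (2 * L) * (norm r)\<^sup>2"
    by linarith
  moreover have "grad f y \<bullet> r - grad f x \<bullet> r = (norm r)\<^sup>2"
    by (simp add: r_def power2_norm_eq_inner inner_diff_left)
  then have "(1 / L) * (grad f y \<bullet> r) - (1 / L) * (grad f x \<bullet> r) = 2 * (1 / (2 * L) * (norm r)\<^sup>2)"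
    by (simp add: diff_divide_distrib[symmetric])
  ultimately show ?thesis
    unfolding r_def by linarith
qed

lemma cocoercive:
  fixes f :: "'v::euclidean_space \<Rightarrow> real"
  assumes "convex_on UNIV f" "L_smooth L f" "0 < L"
  shows "1 / L * (norm (grad f x - grad f y))\<^sup>2 \<le> (grad f x - grad f y) \<bullet> (x - y)"
proof -
  have "f x + grad f x \<bullet> (y - x) + 1 / (2 * L) * (norm (grad f x - grad f y))\<^sup>2 \<le> f y"
    using cocoercive_aux[OF assms, of x y] by (simp add: norm_minus_commute)
  moreover have "f y + grad f y \<bullet> (x - y) + 1 / (2 * L) * (norm (grad f x - grad f y))\<^sup>2 \<le> f x"
    using cocoercive_aux[OF assms, of y x] .
  moreover have "1 / L * (norm (grad f x - grad f y))\<^sup>2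
      = 2 * (1 / (2 * L) * (norm (grad f x - grad f y))\<^sup>2)"
    by (simp add: field_simps)
  ultimately show ?thesis
    by (simp add: inner_diff_left inner_diff_right) 
qed

lemma cocoercive_three_point:
  fixes f :: "'v::euclidean_space \<Rightarrow> real"
  assumes "convex_on UNIV f" "L_smooth L f" "0 < L"
  shows "- (L / 4 * (norm (x - y))\<^sup>2) \<le> (grad f x - grad f z) \<bullet> (y - z)"
proof -
  define r where "r = grad f x - grad f z"
  have "0 \<le> 1 / L * (norm (r - (L / 2) *\<^sub>R (x - y)))\<^sup>2"
    using assms by simp
  also have "\<dots> = 1 / L * (norm r)\<^sup>2 - r \<bullet> (x - y) + L / 4 * (norm (x - y))\<^sup>2"
  proof -
    have "(norm (r - (L / 2) *\<^sub>R (x - y)))\<^sup>2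
        = (norm r)\<^sup>2 - L * (r \<bullet> (x - y)) + L\<^sup>2 / 4 * (norm (x - y))\<^sup>2"
      using dot_norm_neg[of r "(L / 2) *\<^sub>R (x - y)"]
      by (simp add: power_mult_distrib power_divide del: scaleR_right_diff_distrib)
    then show ?thesis
      using \<open>0 < L\<close> by (simp add: field_simps power2_eq_square)
  qed
  also have "1 / L * (norm r)\<^sup>2 \<le> r \<bullet> (x - z)"
    unfolding r_def by (rule cocoercive[OF assms])
  finally show ?thesis
    unfolding r_def[symmetric] by (simp add: inner_diff_right)
qed

lemma GDERIV_stack_sum:
  fixes f :: "'a::finite \<Rightarrow> 'v::euclidean_space \<Rightarrow> real"
  assumes "\<And>i. f i differentiable (at (x $ i))"
  shows "GDERIV (stack_sum f) x :> (\<chi> i. grad (f i) (x $ i))"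
proof -
  have "((\<lambda>x. f i (x $ i)) has_derivative (\<lambda>h. h $ i \<bullet> grad (f i) (x $ i))) (at x)" for i
    using has_derivative_compose[OF
        bounded_linear_imp_has_derivative[OF bounded_linear_vec_nth]
        GDERIV_grad[OF assms, unfolded gderiv_def]] .
  then have "((\<lambda>x. \<Sum>i\<in>UNIV. f i (x $ i)) has_derivative
      (\<lambda>h. \<Sum>i\<in>UNIV. h $ i \<bullet> grad (f i) (x $ i))) (at x)"
    by (intro has_derivative_sum)
  then show ?thesis
    by (simp add: gderiv_def stack_sum_def[abs_def] inner_vec_def)
qed

lemmas grad_stack_sum = grad_eqI[OF GDERIV_stack_sum]

lemma grad_stack_sum_nth:
  fixes f :: "'a::finite \<Rightarrow> 'v::euclidean_space \<Rightarrow> real"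
  assumes "\<And>i. L_smooth (L i) (f i)"
  shows "grad (stack_sum f) x $ i = grad (f i) (x $ i)"
  using assms by (subst grad_stack_sum) (auto simp: L_smooth_def)

lemma GDERIV_quadratic:
  fixes H :: "'v::euclidean_space \<Rightarrow> 'v"
  assumes "linear H" "\<And>x y. H x \<bullet> y = x \<bullet> H y"
  shows "GDERIV (\<lambda>y. 1 / 2 * ((y - v) \<bullet> H (y - v))) p :> H (p - v)"
proof -
  have H: "(H has_derivative H) F" for F
    using assms(1) by (simp add: bounded_linear_imp_has_derivative linear_conv_bounded_linear)
  have "((\<lambda>y. H (y - v)) has_derivative H) (at p)"
    by (rule has_derivative_compose[OF _ H, of "\<lambda>y. y - v" "\<lambda>h. h", simplified])
      (auto intro!: derivative_eq_intros)
  then have "((\<lambda>y. 1 / 2 * ((y - v) \<bullet> H (y - v))) has_derivative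
      (\<lambda>h. 1 / 2 * ((p - v) \<bullet> H h + h \<bullet> H (p - v)))) (at p)"
    by (auto intro!: derivative_eq_intros)
  moreover have "(\<lambda>h. 1 / 2 * ((p - v) \<bullet> H h + h \<bullet> H (p - v))) = (\<lambda>h. h \<bullet> H (p - v))"
    using assms(2)[of "p - v"] by (auto simp: inner_commute)
  ultimately show ?thesis
    by (simp add: gderiv_def)
qed

subsection \<open>Extended-valued convex functions\<close>

lemma epi_convexD:
  assumes "convex (epi h)" "h x \<le> ereal a" "h y \<le> ereal b" "0 \<le> s" "0 \<le> t" "s + t = 1"
  shows "h (s *\<^sub>R x + t *\<^sub>R y) \<le> ereal (s * a + t * b)"
  using convexD[OF assms(1), of "(x, a)" "(y, b)" s t] assms(2-) by (auto simp: epi_def)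

lemma subdiff_arg_min:
  assumes cvx: "convex (epi h)" and nm: "\<And>x. h x \<noteq> -\<infinity>" and proper: "\<exists>x. h x \<noteq> \<infinity>"
    and D: "GDERIV \<psi> p :> D"
    and min: "\<And>y. h p + ereal (\<psi> p) \<le> h y + ereal (\<psi> y)"
  shows "h p \<noteq> \<infinity>" "- D \<in> subdiff h p"
proof -
  show fin: "h p \<noteq> \<infinity>"
    using proper min nm by (metis ereal_plus_eq_PInfty ereal_infty_less_eq(1) PInfty_neq_ereal(1))
  then obtain a where a: "h p = ereal a"
    using nm by (cases "h p") auto
  have "h p + ereal (- D \<bullet> (y - p)) \<le> h y" for y
  proof (cases "h y")
    case (real b)
    define \<theta> where "\<theta> = (\<lambda>t. \<psi> (p + t *\<^sub>R (y - p)) + t * (b - a))"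
    have \<theta>: "(\<theta> has_real_derivative (D \<bullet> (y - p) + (b - a))) (at 0)"
      unfolding \<theta>_def using D by (auto intro!: derivative_eq_intros GDERIV_line)
    have le: "\<theta> 0 \<le> \<theta> t" if t: "0 \<le> t" "t \<le> 1" for t
    proof -
      have "h p + ereal (\<psi> p) \<le> h ((1 - t) *\<^sub>R p + t *\<^sub>R y) + ereal (\<psi> (p + t *\<^sub>R (y - p)))"
        using min[of "p + t *\<^sub>R (y - p)"] by (simp add: algebra_simps)
      also have "\<dots> \<le> ereal ((1 - t) * a + t * b) + ereal (\<psi> (p + t *\<^sub>R (y - p)))"
        using t a real by (intro add_right_mono epi_convexD[OF cvx]) auto
      finally show ?thesis
        by (simp add: a \<theta>_def algebra_simps)
    qed
    have "0 \<le> D \<bullet> (y - p) + (b - a)"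
    proof (rule ccontr)
      assume "\<not> ?thesis"
      then obtain e where e: "e > 0" "\<And>t. 0 < t \<Longrightarrow> t < e \<Longrightarrow> \<theta> t < \<theta> 0"
        using DERIV_neg_dec_right[OF \<theta>] by auto
      have "0 < min (e / 2) 1" "min (e / 2) 1 < e" "min (e / 2) 1 \<le> 1"
        using e(1) by auto
      with e(2) le show False
        by (meson less_le_not_le)
    qed
    then show ?thesis
      by (simp add: a real)
  qed (use nm in auto)
  then show "- D \<in> subdiff h p"
    by (simp add: subdiff_def)
qed

lemma stack_sum_neq_MInf: "(\<And>i x. g i x \<noteq> -\<infinity>) \<Longrightarrow> stack_sum g x \<noteq> (-\<infinity>::ereal)"
proof -
  assume *: "\<And>i x. g i x \<noteq> -\<infinity>"
  have "sum (\<lambda>i. g i (x $ i)) A \<noteq> -\<infinity>" for A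
    by (induction A rule: infinite_finite_induct) (use * in auto)
  then show ?thesis
    by (simp add: stack_sum_def)
qed

lemma stack_sum_le_ereal:
  fixes x :: "'v ^ 'a::finite"
  assumes "\<And>i x. g i x \<noteq> -\<infinity>" "stack_sum g x \<le> ereal s"
  obtains a where "\<And>i. g i (x $ i) = ereal (a i)" "(\<Sum>i\<in>UNIV. a i) \<le> s"
proof -
  have "stack_sum g x \<noteq> \<infinity>"
    using assms(2) by auto
  then have "g i (x $ i) \<noteq> \<infinity>" for i
    by (auto simp: stack_sum_def sum_Pinfty)
  then have a: "g i (x $ i) = ereal (real_of_ereal (g i (x $ i)))" for i
    using assms(1)[of i "x $ i"] by (cases "g i (x $ i)") auto
  then have "stack_sum g x = ereal (\<Sum>i\<in>UNIV. real_of_ereal (g i (x $ i)))"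
    unfolding stack_sum_def sum_ereal[symmetric] using a by (intro sum.cong) auto
  with assms(2) show ?thesis
    by (intro that[OF a]) simp
qed

lemma convex_epi_stack_sum:
  fixes g :: "'a::finite \<Rightarrow> 'v::real_normed_vector \<Rightarrow> ereal"
  assumes "\<And>i. convex (epi (g i))" "\<And>i x. g i x \<noteq> -\<infinity>"
  shows "convex (epi (stack_sum g))"
proof (rule convexI)
  fix P Q :: "('v ^ 'a) \<times> real" and s t :: real
  assume P: "P \<in> epi (stack_sum g)" and Q: "Q \<in> epi (stack_sum g)"
    and st: "0 \<le> s" "0 \<le> t" "s + t = 1"
  obtain x c where Pe: "P = (x, c)" by (cases P)
  obtain y e where Qe: "Q = (y, e)" by (cases Q)
  obtain a where a: "\<And>i. g i (x $ i) = ereal (a i)" "(\<Sum>i\<in>UNIV. a i) \<le> c"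
    using stack_sum_le_ereal[of g x c] P assms(2) by (auto simp: Pe epi_def)
  obtain b where b: "\<And>i. g i (y $ i) = ereal (b i)" "(\<Sum>i\<in>UNIV. b i) \<le> e"
    using stack_sum_le_ereal[of g y e] Q assms(2) by (auto simp: Qe epi_def)
  have "stack_sum g (s *\<^sub>R x + t *\<^sub>R y) \<le> (\<Sum>i\<in>UNIV. ereal (s * a i + t * b i))"
    unfolding stack_sum_def
    using epi_convexD[OF assms(1)] a(1) b(1) st by (intro sum_mono) simp
  also have "\<dots> = ereal (s * (\<Sum>i\<in>UNIV. a i) + t * (\<Sum>i\<in>UNIV. b i))"
    by (simp add: sum.distrib sum_distrib_left)
  also have "\<dots> \<le> ereal (s * c + t * e)"
    using a b st by (simp add: add_mono mult_left_mono)
  finally show "s *\<^sub>R P + t *\<^sub>R Q \<in> epi (stack_sum g)"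
    by (simp add: Pe Qe epi_def)
qed

lemma convex_epi_average:
  assumes "convex (epi h)" "\<And>k. h (z k) \<le> ereal (r k)" "0 < K"
  shows "h (average z K) \<le> ereal ((\<Sum>k<K. r k) / real K)"
proof -
  have "(\<Sum>k<K. (1 / real K) *\<^sub>R (z k, r k)) \<in> epi h"
    using assms by (intro convex_sum) (auto simp: epi_def)
  also have "(\<Sum>k<K. (1 / real K) *\<^sub>R (z k, r k)) = (average z K, (\<Sum>k<K. r k) / real K)"
    by (simp add: prod_eq_iff fst_sum snd_sum average_def scaleR_sum_right sum_divide_distrib)
  finally show ?thesis
    by (simp add: epi_def)
qed

subsection \<open>Block operators and the mixing matrix\<close>

lemma inner_diff_square: "(a - b) \<bullet> (a - b) = a \<bullet> a - 2 * (a \<bullet> b) + b \<bullet> b"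
  by (simp add: inner_diff_left inner_diff_right inner_commute)

lemma finite_pos_lower_bound:
  fixes h :: "'a::finite \<Rightarrow> real"
  assumes "\<And>i. 0 < h i"
  obtains c where "0 < c" "\<And>i. c \<le> h i"
  using assms by (intro that[of "Min (range h)"]) auto

lemma linear_average: "linear h \<Longrightarrow> h (average z K) = average (h \<circ> z) K"
  by (simp add: average_def linear_cmul linear_sum)

lemma sum_eq_average: "1 \<le> K \<Longrightarrow> (\<Sum>k<K. z k) = real K *\<^sub>R average z K"
  by (simp add: average_def)

lemma block_diag_linear: "linear (block_diag c)"
  by (rule linearI) (auto simp: block_diag_def vec_eq_iff algebra_simps)

lemma inner_blocks: "x \<bullet> y = (\<Sum>i\<in>UNIV. x $ i \<bullet> y $ i)" for x y :: "real ^ 'n ^ 'a"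
  by (rule inner_vec_def)

lemma block_diag_inner: "block_diag c x \<bullet> y = (\<Sum>i\<in>UNIV. c i * (x $ i \<bullet> y $ i))"
  by (simp add: block_diag_def inner_blocks)

lemma block_diag_self_adjoint: "block_diag c x \<bullet> y = x \<bullet> block_diag c y"
  by (simp add: block_diag_def inner_blocks)

lemma block_diag_inverse:
  "(\<And>i. c i \<noteq> 0) \<Longrightarrow> block_diag (\<lambda>i. inverse (c i)) (block_diag c x) = x"
  by (simp add: block_diag_def vec_eq_iff)

lemma block_diag_mono: "(\<And>i. c i \<le> e i) \<Longrightarrow> block_diag c x \<bullet> x \<le> block_diag e x \<bullet> x"
  by (simp add: block_diag_inner sum_mono mult_right_mono)

lemma block_diag_const: "block_diag (\<lambda>i. c) x = c *\<^sub>R x"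
  by (simp add: block_diag_def vec_eq_iff)

lemma norm_le_sum_blocks: "norm a \<le> (\<Sum>i\<in>UNIV. norm (a $ i))" for a :: "real ^ 'n ^ 'a"
  unfolding norm_vec_def by (rule L2_set_le_sum) auto

lemma kron_id_inner_ge:
  fixes W :: "real ^ 'a ^ 'a" and q :: "real ^ 'n ^ 'a"
  assumes W: "mixing_matrix E W" and m: "\<And>i. m \<le> W $ i $ i"
  shows "(2 * m - 1) * (q \<bullet> q) \<le> q \<bullet> kron_id W q"
proof -
  have W0: "\<And>i j. 0 \<le> W $ i $ j" and row: "\<And>i. (\<Sum>j\<in>UNIV. W $ i $ j) = 1"
    and col: "\<And>j. (\<Sum>i\<in>UNIV. W $ i $ j) = 1"
    using W by (auto simp: mixing_matrix_def)
  define s where "s = (\<lambda>i j. W $ i $ j * (norm (q $ i + q $ j))\<^sup>2)"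
  have s: "s i j = W $ i $ j * (q $ i \<bullet> q $ i) + W $ i $ j * (q $ j \<bullet> q $ j)
      + 2 * (W $ i $ j * (q $ i \<bullet> q $ j))" for i j
    unfolding s_def dot_norm[of "q $ i"] power2_norm_eq_inner[symmetric]
    by (simp add: field_simps)
  have "4 * m * (q \<bullet> q) = (\<Sum>i\<in>UNIV. 4 * m * (q $ i \<bullet> q $ i))"
    by (simp only: inner_blocks[of q] sum_distrib_left)
  also have "\<dots> \<le> (\<Sum>i\<in>UNIV. s i i)"
  proof (intro sum_mono)
    fix i
    have "m * (q $ i \<bullet> q $ i) \<le> W $ i $ i * (q $ i \<bullet> q $ i)"
      by (intro mult_right_mono m) auto
    then show "4 * m * (q $ i \<bullet> q $ i) \<le> s i i"
      unfolding s by linarith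
  qed
  also have "\<dots> \<le> (\<Sum>i\<in>UNIV. \<Sum>j\<in>UNIV. s i j)"
    using W0 by (intro sum_mono member_le_sum) (auto simp: s_def)
  also have "\<dots> = (\<Sum>i\<in>UNIV. \<Sum>j\<in>UNIV. W $ i $ j * (q $ i \<bullet> q $ i))
      + (\<Sum>i\<in>UNIV. \<Sum>j\<in>UNIV. W $ i $ j * (q $ j \<bullet> q $ j))
      + 2 * (\<Sum>i\<in>UNIV. \<Sum>j\<in>UNIV. W $ i $ j * (q $ i \<bullet> q $ j))"
    by (simp only: s sum.distrib sum_distrib_left)
  also have "(\<Sum>i\<in>UNIV. \<Sum>j\<in>UNIV. W $ i $ j * (q $ i \<bullet> q $ i)) = q \<bullet> q"
    by (simp only: sum_distrib_right[symmetric] row inner_blocks mult_1)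
  also have "(\<Sum>i\<in>UNIV. \<Sum>j\<in>UNIV. W $ i $ j * (q $ j \<bullet> q $ j)) = q \<bullet> q"
    by (subst sum.swap) (simp only: sum_distrib_right[symmetric] col inner_blocks mult_1)
  also have "(\<Sum>i\<in>UNIV. \<Sum>j\<in>UNIV. W $ i $ j * (q $ i \<bullet> q $ j)) = q \<bullet> kron_id W q"
    by (simp add: kron_id_def inner_blocks inner_sum_right)
  finally show ?thesis
    by (simp add: algebra_simps)
qed

subsection \<open>Quasi-Fejer monotone and summable sequences\<close>

lemma quasi_fejer:
  fixes \<Phi> D e :: "nat \<Rightarrow> real"
  assumes step: "\<And>k. \<Phi> (Suc k) + D k \<le> \<Phi> k + e k * (1 + \<Phi> k)"
    and nn: "\<And>k. 0 \<le> \<Phi> k" "\<And>k. 0 \<le> D k" "\<And>k. 0 \<le> e k" and e: "summable e"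
  shows "\<exists>B. \<forall>k. \<Phi> k \<le> B" "summable D"
proof -
  define B where "B = (1 + \<Phi> 0) * exp (suminf e)"
  have 1: "1 + \<Phi> k \<le> (1 + \<Phi> 0) * exp (\<Sum>j<k. e j)" for k
  proof (induction k)
    case (Suc k)
    have "1 + \<Phi> (Suc k) \<le> (1 + \<Phi> k) * (1 + e k)"
      using step[of k] nn(2)[of k] by (simp add: algebra_simps)
    also have "\<dots> \<le> ((1 + \<Phi> 0) * exp (\<Sum>j<k. e j)) * exp (e k)"
      using Suc nn by (intro mult_mono) (auto intro: add_nonneg_nonneg)
    finally show ?case
      by (simp add: exp_add mult.assoc)
  qed simp
  have 2: "1 + \<Phi> k \<le> B" for k
  proof -
    note 1[of k]
    also have "(1 + \<Phi> 0) * exp (\<Sum>j<k. e j) \<le> B"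
      unfolding B_def using e nn by (intro mult_left_mono) (auto intro: sum_le_suminf)
    finally show ?thesis .
  qed
  show "\<exists>B. \<forall>k. \<Phi> k \<le> B"
    using 2 by (intro exI[of _ B]) (smt (verit))
  have "(\<Sum>k<K. D k) \<le> \<Phi> 0 + suminf e * B" for K
  proof -
    have "(\<Sum>k<K. D k) \<le> (\<Sum>k<K. (\<Phi> k - \<Phi> (Suc k)) + e k * B)"
    proof (intro sum_mono)
      fix k
      have "e k * (1 + \<Phi> k) \<le> e k * B"
        using 2 nn by (intro mult_left_mono) auto
      with step[of k] show "D k \<le> (\<Phi> k - \<Phi> (Suc k)) + e k * B"
        by linarith
    qed
    also have "\<dots> = \<Phi> 0 - \<Phi> K + (\<Sum>k<K. e k) * B"
      by (simp add: sum.distrib sum_lessThan_telescope' sum_distrib_right)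
    also have "(\<Sum>k<K. e k) * B \<le> suminf e * B"
      using e nn order_trans[OF _ 2[of 0], of 0] by (intro mult_right_mono sum_le_suminf) auto
    finally show ?thesis
      using nn(1)[of K] by linarith
  qed
  then show "summable D"
    using nn by (intro summableI_nonneg_bounded) auto
qed

lemma summable_average_bigo:
  fixes a :: "nat \<Rightarrow> real"
  assumes "summable a" "\<And>k. 0 \<le> a k"
  shows "(\<lambda>K. 1 / real (K + 1) * (\<Sum>k=0..K. a k)) \<in> O(\<lambda>K. 1 / real (K + 1))"
proof (rule bigoI[of _ "suminf a"], intro always_eventually allI)
  fix K
  have "(\<Sum>k=0..K. a k) \<le> suminf a" "0 \<le> (\<Sum>k=0..K. a k)"
    using assms by (auto intro: sum_le_suminf sum_nonneg)
  then show "norm (1 / real (K + 1) * (\<Sum>k=0..K. a k)) \<le> suminf a * norm (1 / real (K + 1))"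
    by (simp add: divide_right_mono)
qed

lemma summable_Min_smallo:
  fixes a :: "nat \<Rightarrow> real"
  assumes "summable a" "\<And>k. 0 \<le> a k"
  shows "(\<lambda>K. Min (a ` {0..K})) \<in> o(\<lambda>K. 1 / real (K + 1))"
proof (rule landau_o.smallI)
  fix c :: real assume c: "0 < c"
  obtain N where N: "\<And>m n. N \<le> m \<Longrightarrow> norm (sum a {m..<n}) < c / 4"
    using assms(1) c unfolding summable_Cauchy by (meson divide_pos_pos zero_less_numeral)
  show "\<forall>\<^sub>F K in sequentially. norm (Min (a ` {0..K})) \<le> c * norm (1 / real (K + 1))"
    using eventually_ge_at_top[of "2 * N + 1"]
  proof eventually_elim
    case (elim K)
    define m where "m = Min (a ` {0..K})"
    have m0: "0 \<le> m"
      using assms(2) by (auto simp: m_def)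
    have "real (K + 1 - N) * m = (\<Sum>k=N..<K + 1. m)"
      by simp
    also have "\<dots> \<le> sum a {N..<K + 1}"
      unfolding m_def by (intro sum_mono Min_le) auto
    also have "\<dots> \<le> c / 4"
      using N[of N "K + 1"] by simp
    finally have "real (K + 1 - N) * m \<le> c / 4" .
    moreover have "real (K + 1) / 4 * m \<le> real (K + 1 - N) * m"
      using elim m0 by (intro mult_right_mono) (auto simp: of_nat_diff)
    ultimately have "real (K + 1) * m \<le> c"
      by linarith
    then show ?case
      using m0 by (simp add: m_def[symmetric] field_simps)
  qed
qed

subsection \<open>One step of the iteration\<close>

locale d_ipgm =
  fixes f :: "'a::finite \<Rightarrow> real ^ 'n \<Rightarrow> real"
    and g :: "'a \<Rightarrow> real ^ 'n \<Rightarrow> ereal"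
    and L \<tau> :: "'a \<Rightarrow> real"
    and E :: "('a \<times> 'a) set"
    and W :: "real ^ 'a ^ 'a"
    and V :: "real ^ 'n ^ 'a \<Rightarrow> real ^ 'n ^ 'a"
    and \<beta> :: real
    and \<epsilon> :: "nat \<Rightarrow> real"
    and d :: "nat \<Rightarrow> real ^ 'n ^ 'a"
    and u ut :: "nat \<Rightarrow> (real ^ 'n ^ 'a) \<times> (real ^ 'n ^ 'a)"
  assumes f_convex: "\<And>i. convex_on UNIV (f i)"
    and L_pos: "\<And>i. 0 < L i"
    and f_smooth: "\<And>i. L_smooth (L i) (f i)"
    and g_pcc: "\<And>i. proper_closed_convex (g i)"
    and W_mixing: "mixing_matrix E W"
    and V_sqrt: "psd_sqrt (\<lambda>x. x - kron_id W x) V"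
    and strong_duality: "saddle_points f g V \<noteq> {}"
    and d_bound: "\<And>k i. norm (d k $ i) \<le> \<epsilon> k"
    and iterates: "D_iPGM f g V \<tau> \<beta> d u ut"
    and tau: "\<And>i. 0 < \<tau> i \<and> \<tau> i < 2 / L i"
    and beta: "0 < \<beta>" "\<beta> \<le> 0.5 / Max (range \<tau>)"
    and eps_summable: "summable (\<lambda>k. \<epsilon> (Suc k))"
begin

abbreviation "F \<equiv> stack_sum f"
abbreviation "G \<equiv> stack_sum g"
abbreviation "Gm \<equiv> (block_diag \<tau> :: real ^ 'n ^ 'a \<Rightarrow> real ^ 'n ^ 'a)"
abbreviation "Gi \<equiv> (block_diag (\<lambda>i. inverse (\<tau> i)) :: real ^ 'n ^ 'a \<Rightarrow> real ^ 'n ^ 'a)"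
abbreviation "x k \<equiv> fst (u k)"
abbreviation "\<alpha> k \<equiv> snd (u k)"
abbreviation "xt k \<equiv> fst (ut k)"
abbreviation "\<alpha>t k \<equiv> snd (ut k)"
abbreviation "p k \<equiv> x k - xt k"
abbreviation "q k \<equiv> \<alpha> k - \<alpha>t k"

definition \<Phi> :: "nat \<Rightarrow> real ^ 'n ^ 'a \<Rightarrow> real ^ 'n ^ 'a \<Rightarrow> real" where
  "\<Phi> k z w = Gi (x k - z) \<bullet> (x k - z) + (\<alpha> k - w) \<bullet> (\<alpha> k - w) / \<beta>"

definition sg :: "nat \<Rightarrow> real ^ 'n ^ 'a" where
  "sg k = Gi (p k) - grad F (x k) + V (\<alpha> k) + d k"

lemma V_linear: "linear V" and V_self_adjoint: "V a \<bullet> b = a \<bullet> V b"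
  and V_V: "V (V a) = a - kron_id W a"
  using V_sqrt by (auto simp: psd_sqrt_def fun_eq_iff)

lemmas V_simps = linear_add[OF V_linear] linear_diff[OF V_linear] linear_cmul[OF V_linear]
  linear_0[OF V_linear]

lemmas block_diag_uminus = linear_neg[OF block_diag_linear]

lemmas Gi_simps = linear_add[OF block_diag_linear] linear_diff[OF block_diag_linear]

lemma tau_pos: "0 < \<tau> i" "\<tau> i \<noteq> 0"
  using tau[of i] by auto

lemma Gi_Gm: "Gi (Gm a) = a"
  using tau_pos(2) by (rule block_diag_inverse)

lemma g_neq_MInf: "g i y \<noteq> -\<infinity>" and g_convex: "convex (epi (g i))" and g_proper: "\<exists>y. g i y \<noteq> \<infinity>"
  using g_pcc[of i] by (auto simp: proper_closed_convex_def)

lemma G_neq_MInf: "G z \<noteq> -\<infinity>"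
  by (intro stack_sum_neq_MInf g_neq_MInf)

lemma G_convex: "convex (epi G)"
  by (intro convex_epi_stack_sum g_convex g_neq_MInf)

lemma G_proper: "\<exists>z. G z \<noteq> \<infinity>"
proof -
  obtain y where "\<And>i. g i (y i) \<noteq> \<infinity>"
    using g_proper by metis
  then show ?thesis
    by (intro exI[of _ "\<chi> i. y i"]) (auto simp: stack_sum_def sum_Pinfty)
qed

lemma F_GDERIV: "GDERIV F z :> grad F z"
proof -
  have "GDERIV F z :> (\<chi> i. grad (f i) (z $ i))"
    using f_smooth by (intro GDERIV_stack_sum) (auto simp: L_smooth_def)
  with grad_eqI[OF this] show ?thesis
    by simp
qed

lemmas grad_F = grad_stack_sum_nth[of L f, OF f_smooth]

lemma F_ge_tangent: "F z + grad F z \<bullet> (y - z) \<le> F y"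
proof -
  have "f i (z $ i) + grad (f i) (z $ i) \<bullet> (y $ i - z $ i) \<le> f i (y $ i)" for i
    using f_convex f_smooth by (intro convex_ge_tangent) (auto simp: L_smooth_def)
  then show ?thesis
    by (simp add: stack_sum_def inner_blocks grad_F sum.distrib[symmetric] sum_mono)
qed

lemma F_le_quadratic: "F y \<le> F z + grad F z \<bullet> (y - z) + 1 / 2 * (block_diag L (y - z) \<bullet> (y - z))"
proof -
  have "f i (y $ i) \<le> f i (z $ i) + grad (f i) (z $ i) \<bullet> (y $ i - z $ i)
      + 1 / 2 * (L i * ((y $ i - z $ i) \<bullet> (y $ i - z $ i)))" for i
    using L_smooth_le_quadratic[OF f_smooth, of i "y $ i" "z $ i"]
    by (simp add: power2_norm_eq_inner)
  then have "F y \<le> (\<Sum>i\<in>UNIV. f i (z $ i) + grad (f i) (z $ i) \<bullet> (y $ i - z $ i)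
      + 1 / 2 * (L i * ((y $ i - z $ i) \<bullet> (y $ i - z $ i))))"
    unfolding stack_sum_def by (rule sum_mono)
  then show ?thesis
    by (simp add: stack_sum_def inner_blocks[of "grad F z"] block_diag_inner grad_F sum.distrib
        sum_divide_distrib)
qed

lemma F_three_point:
  "- (1 / 4 * (block_diag L (y - z) \<bullet> (y - z))) \<le> (grad F y - grad F w) \<bullet> (z - w)"
proof -
  have "- (1 / 4 * (L i * ((y $ i - z $ i) \<bullet> (y $ i - z $ i))))
      \<le> (grad (f i) (y $ i) - grad (f i) (w $ i)) \<bullet> (z $ i - w $ i)" for i
    using cocoercive_three_point[OF f_convex f_smooth L_pos, of i "y $ i" "z $ i" "w $ i"]
    by (simp add: power2_norm_eq_inner)
  then have "(\<Sum>i\<in>UNIV. - (1 / 4 * (L i * ((y $ i - z $ i) \<bullet> (y $ i - z $ i)))))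
      \<le> (\<Sum>i\<in>UNIV. (grad (f i) (y $ i) - grad (f i) (w $ i)) \<bullet> (z $ i - w $ i))"
    by (rule sum_mono)
  then show ?thesis
    by (simp add: inner_blocks[of "grad F y - grad F w"] block_diag_inner grad_F
        sum_negf sum_divide_distrib)
qed

lemma grad_F_lipschitz: "norm (grad F y - grad F z) \<le> (\<Sum>i\<in>UNIV. L i) * norm (y - z)"
proof -
  have "norm (grad F y - grad F z) \<le> (\<Sum>i\<in>UNIV. norm ((grad F y - grad F z) $ i))"
    by (rule norm_le_sum_blocks)
  also have "\<dots> \<le> (\<Sum>i\<in>UNIV. L i * norm (y - z))"
  proof (intro sum_mono)
    fix i
    have "norm ((grad F y - grad F z) $ i) \<le> L i * norm (y $ i - z $ i)"
      using f_smooth[of i] by (auto simp: grad_F L_smooth_def lipschitz_on_def dist_norm)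
    also have "\<dots> \<le> L i * norm (y - z)"
      using L_pos[of i] Finite_Cartesian_Product.norm_nth_le[of "y - z" i] by (intro mult_left_mono) auto
    finally show "norm ((grad F y - grad F z) $ i) \<le> L i * norm (y - z)" .
  qed
  finally show ?thesis
    by (simp add: sum_distrib_right)
qed

lemma q_eq: "q k = \<beta> *\<^sub>R V (xt k)"
  and x_Suc: "x (Suc k) = xt k - Gm (V (q k))"
  and \<alpha>_Suc: "\<alpha> (Suc k) = \<alpha>t k"
  and xt_prox: "is_prox Gi G (x k - Gm (grad F (x k) - V (\<alpha> k) - d k)) (xt k)"
  using iterates by (auto simp: D_iPGM_def correction_def case_prod_beta)

lemma V_xt: "V (xt k) = (1 / \<beta>) *\<^sub>R q k"
  using beta by (simp add: q_eq)

lemma G_xt: "G (xt k) \<noteq> \<infinity>" and sg_subdiff: "sg k \<in> subdiff G (xt k)"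
proof -
  let ?v = "x k - Gm (grad F (x k) - V (\<alpha> k) - d k)"
  let ?\<psi> = "\<lambda>y. 1 / 2 * ((y - ?v) \<bullet> Gi (y - ?v))"
  have 1: "GDERIV ?\<psi> (xt k) :> Gi (xt k - ?v)"
    by (intro GDERIV_quadratic block_diag_linear block_diag_self_adjoint)
  have 2: "G (xt k) + ereal (?\<psi> (xt k)) \<le> G y + ereal (?\<psi> y)" for y
    using xt_prox[of k] by (auto simp: is_prox_def is_arg_min_def not_less)
  note * = subdiff_arg_min[OF G_convex G_neq_MInf G_proper 1 2]
  show "G (xt k) \<noteq> \<infinity>"
    by (rule *)
  have "- Gi (xt k - ?v) = sg k"
    by (simp add: sg_def Gi_simps Gi_Gm)
  then show "sg k \<in> subdiff G (xt k)"
    using *(2) by simp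
qed

definition Gr :: "real ^ 'n ^ 'a \<Rightarrow> real" where
  "Gr z = real_of_ereal (G z)"

lemma G_real: "G z \<noteq> \<infinity> \<Longrightarrow> G z = ereal (Gr z)"
  using G_neq_MInf[of z] unfolding Gr_def by (cases "G z") auto

lemma subdiff_real:
  assumes "s \<in> subdiff G z" "G z \<noteq> \<infinity>" "G y \<noteq> \<infinity>"
  shows "Gr z + s \<bullet> (y - z) \<le> Gr y"
proof -
  have "G z + ereal (s \<bullet> (y - z)) \<le> G y"
    using assms(1) by (auto simp: subdiff_def)
  then show ?thesis
    by (simp add: G_real assms)
qed

lemma \<Phi>_Suc:
  "\<Phi> (Suc k) z w = \<Phi> k z w - 2 * (Gi (p k) \<bullet> (xt k - z)) - Gi (p k) \<bullet> p k
     - q k \<bullet> q k / \<beta> + Gm (V (q k)) \<bullet> V (q k) - 2 / \<beta> * ((\<alpha> k - w) \<bullet> q k) + 2 * (q k \<bullet> V z)"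
proof -
  define a b r where "a = xt k - z" and "b = \<alpha> k - w" and "r = V (q k)"
  have "r \<bullet> a = q k \<bullet> V (xt k - z)"
    by (simp add: r_def a_def V_self_adjoint)
  then have ra: "r \<bullet> a = q k \<bullet> q k / \<beta> - q k \<bullet> V z"
    by (simp add: V_simps V_xt inner_diff_right)
  have "Gi a \<bullet> Gm r = a \<bullet> r"
    by (simp add: block_diag_self_adjoint[of _ a] Gi_Gm)
  moreover have "x (Suc k) - z = a - Gm r"
    by (simp add: x_Suc a_def r_def)
  ultimately have 1: "Gi (x (Suc k) - z) \<bullet> (x (Suc k) - z) = Gi a \<bullet> a - 2 * (r \<bullet> a) + Gm r \<bullet> r"
    by (simp add: Gi_simps Gi_Gm inner_diff_left inner_diff_right inner_commute)
  have "x k - z = a + p k"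
    by (simp add: a_def)
  moreover have "Gi a \<bullet> p k = Gi (p k) \<bullet> a"
    by (simp add: block_diag_self_adjoint[of _ a] inner_commute)
  ultimately have 2: "Gi (x k - z) \<bullet> (x k - z) = Gi a \<bullet> a + 2 * (Gi (p k) \<bullet> a) + Gi (p k) \<bullet> p k"
    by (simp only: linear_add[OF block_diag_linear] inner_add_left inner_add_right)
  have "\<alpha> (Suc k) - w = b - q k"
    by (simp add: \<alpha>_Suc b_def)
  then have "(\<alpha> (Suc k) - w) \<bullet> (\<alpha> (Suc k) - w) = b \<bullet> b - 2 * (b \<bullet> q k) + q k \<bullet> q k"
    by (metis inner_diff_square)
  then have 3: "(\<alpha> (Suc k) - w) \<bullet> (\<alpha> (Suc k) - w) / \<beta>
      = b \<bullet> b / \<beta> - 2 / \<beta> * (b \<bullet> q k) + q k \<bullet> q k / \<beta>"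
    by (simp add: add_divide_distrib diff_divide_distrib)
  show ?thesis
    using 1 2 3 ra unfolding \<Phi>_def a_def[symmetric] b_def[symmetric] r_def[symmetric] by argo
qed

lemma saddle_point_obtain:
  obtains xs \<alpha>s where "V xs = 0" "G xs \<noteq> \<infinity>" "V \<alpha>s - grad F xs \<in> subdiff G xs"
    "\<And>z. G z \<noteq> \<infinity> \<Longrightarrow> F xs + Gr xs \<le> F z + Gr z - \<alpha>s \<bullet> V z"
proof -
  obtain xs \<alpha>s where "(xs, \<alpha>s) \<in> saddle_points f g V"
    using strong_duality by auto
  then have 1: "\<And>w. lagrangian f g V xs w \<le> lagrangian f g V xs \<alpha>s"
    and 2: "\<And>z. lagrangian f g V xs \<alpha>s \<le> lagrangian f g V z \<alpha>s"
    by (auto simp: saddle_points_def)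
  have lag: "lagrangian f g V z \<alpha>s = G z + ereal (F z - \<alpha>s \<bullet> V z)" for z
    using G_neq_MInf[of z] unfolding lagrangian_def by (cases "G z") auto
  have "GDERIV (\<lambda>z. F z - \<alpha>s \<bullet> V z) xs :> grad F xs - V \<alpha>s"
  proof -
    have "((\<lambda>z. V \<alpha>s \<bullet> z) has_derivative (\<lambda>h. V \<alpha>s \<bullet> h)) (at xs)"
      by (auto intro!: derivative_eq_intros)
    from has_derivative_diff[OF F_GDERIV[unfolded gderiv_def] this] show ?thesis
      by (simp add: gderiv_def V_self_adjoint[of \<alpha>s, symmetric] inner_diff_right
          inner_commute[of _ "V \<alpha>s"])
  qed
  note * = subdiff_arg_min[OF G_convex G_neq_MInf G_proper this 2[unfolded lag]]
  have "V xs = 0"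
  proof -
    have "- ((\<alpha>s - V xs) \<bullet> V xs) \<le> - (\<alpha>s \<bullet> V xs)"
      using 1[of "\<alpha>s - V xs"] by (simp add: lagrangian_def G_real[OF *(1)])
    then have "V xs \<bullet> V xs \<le> 0"
      by (simp add: inner_diff_left)
    then show ?thesis
      by (metis inner_ge_zero inner_eq_zero_iff order_antisym)
  qed
  moreover have "F xs + Gr xs \<le> F z + Gr z - \<alpha>s \<bullet> V z" if "G z \<noteq> \<infinity>" for z
    using 2[of z] \<open>V xs = 0\<close> unfolding lag by (simp add: G_real that *(1))
  ultimately show ?thesis
    using * by (intro that[of xs \<alpha>s]) auto
qed

lemma V_norm_decay:
  obtains c where "0 < c" "\<And>a. c * (a \<bullet> a) \<le> a \<bullet> a / \<beta> - Gm (V a) \<bullet> V a"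
proof -
  obtain m where m: "0 < m" "\<And>i. m \<le> W $ i $ i"
    using W_mixing finite_pos_lower_bound[of "\<lambda>i. W $ i $ i"] by (auto simp: mixing_matrix_def)
  define T where "T = Max (range \<tau>)"
  have T: "\<tau> i \<le> T" for i
    unfolding T_def by (intro Max_ge) auto
  have T0: "0 < T"
    using tau_pos(1) T by (rule order_less_le_trans)
  have "2 * T \<le> 1 / \<beta>"
    using beta T0 unfolding T_def[symmetric] by (simp add: field_simps)
  have "2 * m * T * (a \<bullet> a) \<le> a \<bullet> a / \<beta> - Gm (V a) \<bullet> V a" for a
  proof -
    have "V a \<bullet> V a = a \<bullet> a - a \<bullet> kron_id W a"
      by (simp add: V_self_adjoint V_V inner_diff_right)
    also have "\<dots> \<le> (2 - 2 * m) * (a \<bullet> a)"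
      using kron_id_inner_ge[OF W_mixing m(2), of a] by (simp add: algebra_simps)
    finally have "T * (V a \<bullet> V a) \<le> T * ((2 - 2 * m) * (a \<bullet> a))"
      using T0 by (intro mult_left_mono) auto
    moreover have "Gm (V a) \<bullet> V a \<le> T * (V a \<bullet> V a)"
      using block_diag_mono[of \<tau> "\<lambda>_. T", OF T] by (simp add: block_diag_const)
    moreover have "2 * T * (a \<bullet> a) \<le> 1 / \<beta> * (a \<bullet> a)"
      using \<open>2 * T \<le> 1 / \<beta>\<close> by (intro mult_right_mono) auto
    ultimately show ?thesis
      by (simp add: algebra_simps)
  qed
  then show ?thesis
    using m T0 by (intro that[of "2 * m * T"]) auto
qed

lemma gap_step:
  assumes "\<And>i. \<tau> i < 1 / L i" "G z \<noteq> \<infinity>"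
  shows "2 * ((F (xt k) + Gr (xt k) - w \<bullet> V (xt k)) - (F z + Gr z - \<alpha>t k \<bullet> V z))
    \<le> \<Phi> k z w - \<Phi> (Suc k) z w + 2 * (d k \<bullet> (xt k - z))"
proof -
  have 1: "Gr (xt k) - Gr z \<le> sg k \<bullet> (xt k - z)"
    using subdiff_real[OF sg_subdiff G_xt assms(2), of k] by (simp add: inner_diff_right)
  have "F (xt k) \<le> F (x k) + grad F (x k) \<bullet> (xt k - x k) + 1 / 2 * (block_diag L (p k) \<bullet> p k)"
    using F_le_quadratic[of "xt k" "x k"]
    by (simp only: block_diag_uminus minus_diff_eq[of "x k", symmetric] inner_minus_left inner_minus_right minus_minus)
  moreover have "F (x k) + grad F (x k) \<bullet> (z - x k) \<le> F z"
    by (rule F_ge_tangent)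
  ultimately have 2: "F (xt k) - F z \<le> grad F (x k) \<bullet> (xt k - z) + 1 / 2 * (block_diag L (p k) \<bullet> p k)"
    by (simp add: inner_diff_right)
  have "L i \<le> inverse (\<tau> i)" for i
    using assms(1)[of i] tau_pos[of i] L_pos[of i] by (simp add: field_simps)
  then have 3: "block_diag L (p k) \<bullet> p k \<le> Gi (p k) \<bullet> p k"
    by (rule block_diag_mono)
  have 4: "Gm (V (q k)) \<bullet> V (q k) \<le> q k \<bullet> q k / \<beta>"
  proof -
    obtain c where "0 < c" "c * (q k \<bullet> q k) \<le> q k \<bullet> q k / \<beta> - Gm (V (q k)) \<bullet> V (q k)"
      using V_norm_decay by metis
    moreover have "0 \<le> c * (q k \<bullet> q k)"
      using \<open>0 < c\<close> by simp
    ultimately show ?thesis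
      by linarith
  qed
  have "sg k \<bullet> (xt k - z) + grad F (x k) \<bullet> (xt k - z)
      = Gi (p k) \<bullet> (xt k - z) + d k \<bullet> (xt k - z) + \<alpha> k \<bullet> V (xt k) - \<alpha> k \<bullet> V z"
    unfolding sg_def by (simp add: inner_add_left inner_diff_left V_self_adjoint V_simps inner_diff_right)
  moreover have "\<alpha> k \<bullet> V (xt k) - w \<bullet> V (xt k) = 1 / \<beta> * ((\<alpha> k - w) \<bullet> q k)"
    by (simp add: V_xt inner_diff_left diff_divide_distrib)
  moreover have "\<alpha> k \<bullet> V z - \<alpha>t k \<bullet> V z = q k \<bullet> V z"
    by (simp add: inner_diff_left)
  moreover have "2 * (1 / \<beta> * ((\<alpha> k - w) \<bullet> q k)) = 2 / \<beta> * ((\<alpha> k - w) \<bullet> q k)"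
    by simp
  ultimately show ?thesis
    using 1 2 3 4 \<Phi>_Suc[of k z w] by argo
qed

lemma fejer_step:
  assumes "V xs = 0" "G xs \<noteq> \<infinity>" "V \<alpha>s - grad F xs \<in> subdiff G xs"
  shows "\<Phi> (Suc k) xs \<alpha>s \<le> \<Phi> k xs \<alpha>s - (Gi (p k) \<bullet> p k - 1 / 2 * (block_diag L (p k) \<bullet> p k))
    - (q k \<bullet> q k / \<beta> - Gm (V (q k)) \<bullet> V (q k)) + 2 * (d k \<bullet> (xt k - xs))"
proof -
  let ?y = "xt k - xs"
  have "Gr (xt k) + sg k \<bullet> (xs - xt k) \<le> Gr xs"
    by (rule subdiff_real[OF sg_subdiff G_xt assms(2)])
  moreover have "Gr xs + (V \<alpha>s - grad F xs) \<bullet> (xt k - xs) \<le> Gr (xt k)"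
    by (rule subdiff_real[OF assms(3,2) G_xt])
  ultimately have "0 \<le> sg k \<bullet> ?y - (V \<alpha>s - grad F xs) \<bullet> ?y"
    by (simp add: inner_diff_right)
  also have "\<dots> = Gi (p k) \<bullet> ?y + d k \<bullet> ?y - (grad F (x k) - grad F xs) \<bullet> ?y + (V (\<alpha> k) - V \<alpha>s) \<bullet> ?y"
    by (simp add: sg_def inner_add_left inner_diff_left)
  also have "(V (\<alpha> k) - V \<alpha>s) \<bullet> ?y = 1 / \<beta> * ((\<alpha> k - \<alpha>s) \<bullet> q k)"
    by (simp add: V_simps(2)[symmetric] V_self_adjoint)
      (simp add: V_simps V_xt assms(1))
  finally have 1: "0 \<le> Gi (p k) \<bullet> ?y + d k \<bullet> ?y - (grad F (x k) - grad F xs) \<bullet> ?y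
    + 1 / \<beta> * ((\<alpha> k - \<alpha>s) \<bullet> q k)" .
  have "2 * (1 / \<beta> * ((\<alpha> k - \<alpha>s) \<bullet> q k)) = 2 / \<beta> * ((\<alpha> k - \<alpha>s) \<bullet> q k)"
    by simp
  moreover have "q k \<bullet> V xs = 0"
    by (simp add: assms)
  ultimately show ?thesis
    using 1 F_three_point[of "x k" "xt k" xs] \<Phi>_Suc[of k xs \<alpha>s] by argo
qed

lemma d_summable: "summable (\<lambda>k. norm (d k))"
proof -
  have "norm (d k) \<le> real CARD('a) * \<epsilon> k" for k
    using norm_le_sum_blocks[of "d k"] sum_mono[of UNIV "\<lambda>i. norm (d k $ i)" "\<lambda>_. \<epsilon> k"] d_bound
    by force
  moreover have "summable (\<lambda>k. real CARD('a) * \<epsilon> k)"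
    using eps_summable by (simp only: summable_Suc_iff summable_mult)
  ultimately show ?thesis
    using summable_comparison_test'[of "\<lambda>k. real CARD('a) * \<epsilon> k" 0 "\<lambda>k. norm (d k)"] by simp
qed

lemma d_square_summable: "summable (\<lambda>k. (norm (d k))\<^sup>2)"
proof (rule summable_comparison_test_ev[OF _ d_summable])
  have "\<forall>\<^sub>F k in sequentially. norm (d k) < 1"
    using order_tendstoD(2)[OF summable_LIMSEQ_zero[OF d_summable], of 1] by simp
  then show "\<forall>\<^sub>F k in sequentially. norm ((norm (d k))\<^sup>2) \<le> norm (d k)"
    by eventually_elim (simp add: power2_eq_square mult_left_le)
qed

lemma \<Phi>_nonneg: "0 \<le> \<Phi> k z w"
  using beta(1) tau_pos(1) unfolding \<Phi>_def block_diag_inner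
  by (intro add_nonneg_nonneg sum_nonneg) (auto simp: less_imp_le)

lemma norm_square_le_\<Phi>:
  obtains T where "0 \<le> T" "\<And>k z w. (norm (x k - z))\<^sup>2 \<le> T * \<Phi> k z w"
    "\<And>k z w. (norm (\<alpha> k - w))\<^sup>2 \<le> T * \<Phi> k z w"
proof -
  obtain c where c: "0 < c" "\<And>i. c \<le> inverse (\<tau> i)"
    using finite_pos_lower_bound[of "\<lambda>i. inverse (\<tau> i)"] tau_pos by auto
  have 1: "c * (norm (x k - z))\<^sup>2 \<le> Gi (x k - z) \<bullet> (x k - z)" for k z
    using block_diag_mono[of "\<lambda>_. c" "\<lambda>i. inverse (\<tau> i)", OF c(2)]
    by (simp add: block_diag_const power2_norm_eq_inner)
  have 2: "(norm (x k - z))\<^sup>2 \<le> 1 / c * \<Phi> k z w" for k z w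
  proof -
    have "c * (norm (x k - z))\<^sup>2 \<le> \<Phi> k z w"
      using 1[of k z] beta(1) by (simp add: \<Phi>_def add_increasing2)
    then show ?thesis
      using c by (simp add: field_simps)
  qed
  have 3: "(norm (\<alpha> k - w))\<^sup>2 \<le> \<beta> * \<Phi> k z w" for k z w
  proof -
    have "0 \<le> c * (norm (x k - z))\<^sup>2"
      using c by simp
    then show ?thesis
      using 1[of k z] beta(1) by (simp add: \<Phi>_def power2_norm_eq_inner distrib_left)
  qed
  show ?thesis
    using \<Phi>_nonneg 2 3 beta(1) c(1)
    by (intro that[of "1 / c + \<beta>"]) (auto simp: distrib_right intro: add_increasing add_increasing2)
qed

lemma iterates_summable:
  shows "bounded (range u)" "summable (\<lambda>k. (norm (p k))\<^sup>2 + (norm (q k))\<^sup>2)"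
proof -
  obtain xs \<alpha>s where s: "V xs = 0" "G xs \<noteq> \<infinity>" "V \<alpha>s - grad F xs \<in> subdiff G xs"
    using saddle_point_obtain by metis
  obtain T where T: "0 \<le> T" "\<And>k z w. (norm (x k - z))\<^sup>2 \<le> T * \<Phi> k z w"
    "\<And>k z w. (norm (\<alpha> k - w))\<^sup>2 \<le> T * \<Phi> k z w"
    using norm_square_le_\<Phi> by metis
  have "0 < inverse (\<tau> i) - L i / 2" for i
    using tau[of i] L_pos[of i] by (simp add: field_simps)
  then obtain c1 where c1: "0 < c1" "\<And>i. c1 \<le> inverse (\<tau> i) - L i / 2"
    using finite_pos_lower_bound[of "\<lambda>i. inverse (\<tau> i) - L i / 2"] by auto
  obtain c2 where c2: "0 < c2" "\<And>a. c2 * (a \<bullet> a) \<le> a \<bullet> a / \<beta> - Gm (V a) \<bullet> V a"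
    using V_norm_decay by metis
  define c where "c = min (c1 / 2) c2"
  have c: "0 < c" "c \<le> c1 / 2" "c \<le> c2"
    using c1 c2 by (auto simp: c_def)
  define e where "e = (\<lambda>k. (1 + T) * norm (d k) + 2 / c1 * (norm (d k))\<^sup>2)"
  have e0: "0 \<le> e k" for k
    using T(1) c1(1) by (simp add: e_def)
  have step: "\<Phi> (Suc k) xs \<alpha>s + c * ((norm (p k))\<^sup>2 + (norm (q k))\<^sup>2)
      \<le> \<Phi> k xs \<alpha>s + e k * (1 + \<Phi> k xs \<alpha>s)" for k
  proof -
    have "c1 * (norm (p k))\<^sup>2 \<le> block_diag (\<lambda>i. inverse (\<tau> i) - L i / 2) (p k) \<bullet> p k"
      using block_diag_mono[of "\<lambda>_. c1" "\<lambda>i. inverse (\<tau> i) - L i / 2", OF c1(2), of "p k"]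
      by (simp add: block_diag_const power2_norm_eq_inner)
    also have "\<dots> = Gi (p k) \<bullet> p k - 1 / 2 * (block_diag L (p k) \<bullet> p k)"
      by (simp add: block_diag_inner left_diff_distrib sum_subtractf sum_divide_distrib)
    finally have 1: "c1 * (norm (p k))\<^sup>2 \<le> Gi (p k) \<bullet> p k - 1 / 2 * (block_diag L (p k) \<bullet> p k)" .
    have 2: "c2 * (norm (q k))\<^sup>2 \<le> q k \<bullet> q k / \<beta> - Gm (V (q k)) \<bullet> V (q k)"
      using c2(2) by (simp add: power2_norm_eq_inner)
    have "d k \<bullet> (xt k - xs) = d k \<bullet> (x k - xs) - d k \<bullet> p k"
      by (simp add: inner_diff_right)
    moreover have "d k \<bullet> (x k - xs) \<le> norm (d k) * norm (x k - xs)"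
      by (rule norm_cauchy_schwarz)
    moreover have "- (d k \<bullet> p k) \<le> norm (d k) * norm (p k)"
      using norm_cauchy_schwarz[of "- d k" "p k"] by simp
    moreover have "2 * (norm (d k) * norm (x k - xs)) \<le> norm (d k) * (1 + T * \<Phi> k xs \<alpha>s)"
    proof -
      have "2 * norm (x k - xs) \<le> 1 + (norm (x k - xs))\<^sup>2"
        using zero_le_power2[of "norm (x k - xs) - 1"] by (simp add: power2_diff)
      also have "\<dots> \<le> 1 + T * \<Phi> k xs \<alpha>s"
        using T(2) by simp
      finally show ?thesis
        using mult_left_mono[of _ _ "norm (d k)"] by fastforce
    qed
    moreover have "2 * (norm (d k) * norm (p k)) \<le> c1 / 2 * (norm (p k))\<^sup>2 + 2 / c1 * (norm (d k))\<^sup>2"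
    proof -
      have "0 \<le> c1 / 2 * (norm (p k) - 2 / c1 * norm (d k))\<^sup>2"
        using c1 by simp
      also have "\<dots> = c1 / 2 * (norm (p k))\<^sup>2 + 2 / c1 * (norm (d k))\<^sup>2 - 2 * (norm (d k) * norm (p k))"
        using c1(1) by (simp add: power2_eq_square field_simps)
      finally show ?thesis
        by simp
    qed
    ultimately have 3: "2 * (d k \<bullet> (xt k - xs)) \<le> norm (d k) * (1 + T * \<Phi> k xs \<alpha>s)
        + c1 / 2 * (norm (p k))\<^sup>2 + 2 / c1 * (norm (d k))\<^sup>2"
      by linarith
    have 4: "norm (d k) * (1 + T * \<Phi> k xs \<alpha>s) + 2 / c1 * (norm (d k))\<^sup>2 \<le> e k * (1 + \<Phi> k xs \<alpha>s)"
    proof -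
      have "0 \<le> norm (d k) * (T + \<Phi> k xs \<alpha>s)" "0 \<le> 2 / c1 * (norm (d k))\<^sup>2 * \<Phi> k xs \<alpha>s"
        using T(1) c1(1) \<Phi>_nonneg by auto
      moreover have "(1 + T) * n * (1 + P) + r * (1 + P) = n * (1 + T * P) + r + n * (T + P) + r * P"
        for n r P :: real
        by (simp add: algebra_simps)
      ultimately show ?thesis
        unfolding e_def distrib_right[of _ _ "1 + \<Phi> k xs \<alpha>s"] by (metis add_increasing2 order_refl)
    qed
    have "c * (norm (p k))\<^sup>2 \<le> c1 / 2 * (norm (p k))\<^sup>2" "c * (norm (q k))\<^sup>2 \<le> c2 * (norm (q k))\<^sup>2"
      using c by (intro mult_right_mono; simp)+
    then have "c * ((norm (p k))\<^sup>2 + (norm (q k))\<^sup>2) \<le> c1 / 2 * (norm (p k))\<^sup>2 + c2 * (norm (q k))\<^sup>2"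
      by (simp add: distrib_left)
    then show ?thesis
      using fejer_step[OF s, of k] 1 2 3 4 by linarith
  qed
  have e: "summable e"
    unfolding e_def by (intro summable_add summable_mult d_summable d_square_summable)
  note * = quasi_fejer[of "\<lambda>k. \<Phi> k xs \<alpha>s" "\<lambda>k. c * ((norm (p k))\<^sup>2 + (norm (q k))\<^sup>2)" e,
      OF step \<Phi>_nonneg _ e0 e]
  have "summable (\<lambda>k. c * ((norm (p k))\<^sup>2 + (norm (q k))\<^sup>2))"
    using * c(1) by simp
  then show "summable (\<lambda>k. (norm (p k))\<^sup>2 + (norm (q k))\<^sup>2)"
    using c(1) by (simp add: summable_cmult_iff)
  obtain B where B: "\<And>k. \<Phi> k xs \<alpha>s \<le> B"
    using * c(1) by auto
  have "norm (u k) \<le> norm xs + norm \<alpha>s + 2 * sqrt (T * B)" for k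
  proof -
    have "(norm (x k - xs))\<^sup>2 \<le> T * B" "(norm (\<alpha> k - \<alpha>s))\<^sup>2 \<le> T * B"
      using T(2)[of k xs \<alpha>s] T(3)[of k \<alpha>s xs] mult_left_mono[OF B T(1)] by (meson order_trans)+
    then have "norm (x k - xs) \<le> sqrt (T * B)" "norm (\<alpha> k - \<alpha>s) \<le> sqrt (T * B)"
      by (auto intro: real_le_rsqrt)
    moreover have "norm (u k) \<le> norm (x k) + norm (\<alpha> k)"
      using norm_Pair_le[of "x k" "\<alpha> k"] by simp
    ultimately show ?thesis
      using norm_triangle_sub[of "x k" xs] norm_triangle_sub[of "\<alpha> k" \<alpha>s] by linarith
  qed
  then show "bounded (range u)"
    by (auto simp: bounded_iff)
qed

subsection \<open>Convergence rates\<close>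

lemma kkt_dist_square_summable: "summable (\<lambda>k. (kkt_dist f g V (ut k))\<^sup>2)"
proof -
  obtain K1 where K1: "0 < K1" "\<And>a. norm (Gi a) \<le> K1 * norm a"
    using linear_bounded_pos[OF block_diag_linear] by blast
  obtain K2 where K2: "0 < K2" "\<And>a. norm (V a) \<le> K2 * norm a"
    using linear_bounded_pos[OF V_linear] by blast
  define S where "S = (\<Sum>i\<in>UNIV. L i)"
  have S: "0 \<le> S"
    unfolding S_def using L_pos by (intro sum_nonneg) (auto simp: less_imp_le)
  define C where "C = K1 + S + K2 + 1 / \<beta> + 1"
  have C: "K1 + S \<le> C" "K2 + 1 / \<beta> \<le> C" "1 \<le> C" "0 \<le> C"
    using K1(1) K2(1) S beta(1) by (auto simp: C_def)
  have bound: "(kkt_dist f g V (ut k))\<^sup>2 \<le> 3 * C\<^sup>2 * (((norm (p k))\<^sup>2 + (norm (q k))\<^sup>2) + (norm (d k))\<^sup>2)" for k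
  proof -
    let ?r = "sg k + grad F (xt k) - V (\<alpha>t k)"
    have "?r = Gi (p k) + (grad F (xt k) - grad F (x k)) + V (q k) + d k"
      by (simp add: sg_def V_simps)
    also have "norm \<dots> \<le> norm (Gi (p k)) + norm (grad F (xt k) - grad F (x k)) + norm (V (q k)) + norm (d k)"
      by (meson add_mono norm_triangle_le order_refl)
    also have "\<dots> \<le> K1 * norm (p k) + S * norm (p k) + K2 * norm (q k) + norm (d k)"
      using grad_F_lipschitz[of "xt k" "x k"]
      by (intro add_mono K1 K2) (auto simp: S_def norm_minus_commute)
    finally have r: "norm ?r \<le> (K1 + S) * norm (p k) + K2 * norm (q k) + norm (d k)"
      by (simp add: distrib_right)
    have "(?r, V (xt k)) \<in> kkt f g V (ut k)"
      using sg_subdiff by (auto simp: kkt_def case_prod_beta)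
    then have "kkt_dist f g V (ut k) \<le> dist 0 (?r, V (xt k))"
      unfolding kkt_dist_def by (rule infdist_le)
    also have "\<dots> \<le> norm ?r + norm (V (xt k))"
      using norm_Pair_le[of ?r "V (xt k)"] by (simp only: dist_0_norm)
    also have "\<dots> \<le> (K1 + S) * norm (p k) + (K2 + 1 / \<beta>) * norm (q k) + 1 * norm (d k)"
      using r beta(1) by (simp add: V_xt distrib_right)
    also have "\<dots> \<le> C * norm (p k) + C * norm (q k) + C * norm (d k)"
      by (intro add_mono mult_right_mono C norm_ge_zero)
    finally have "(kkt_dist f g V (ut k))\<^sup>2 \<le> (C * (norm (p k) + norm (q k) + norm (d k)))\<^sup>2"
      by (intro power_mono) (auto simp: distrib_left kkt_dist_def infdist_nonneg)
    also have "\<dots> \<le> C\<^sup>2 * (3 * ((norm (p k))\<^sup>2 + (norm (q k))\<^sup>2 + (norm (d k))\<^sup>2))"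
    proof -
      have "(a + b + c)\<^sup>2 \<le> 3 * (a\<^sup>2 + b\<^sup>2 + c\<^sup>2)" for a b c :: real
        using zero_le_power2[of "a - b"] zero_le_power2[of "b - c"] zero_le_power2[of "a - c"]
        by (simp add: power2_eq_square algebra_simps)
      then show ?thesis
        unfolding power_mult_distrib by (intro mult_left_mono) auto
    qed
    finally show ?thesis
      by (simp only: mult.assoc mult.left_commute)
  qed
  have "summable (\<lambda>k. 3 * C\<^sup>2 * (((norm (p k))\<^sup>2 + (norm (q k))\<^sup>2) + (norm (d k))\<^sup>2))"
    by (intro summable_mult summable_add[OF iterates_summable(2) d_square_summable])
  then show ?thesis
    by (rule summable_comparison_test'[where N = 0]) (simp add: bound)
qed

lemma xt_bounded: obtains R where "\<And>k. norm (xt k) \<le> R"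
proof -
  obtain K where K: "0 < K" "\<And>a. norm ((Gm \<circ> V) a) \<le> K * norm a"
    using linear_bounded_pos[OF linear_compose[OF V_linear block_diag_linear]] by metis
  obtain B where B: "\<And>k. norm (u k) \<le> B"
    using iterates_summable(1) by (auto simp: bounded_iff)
  have "norm (xt k) \<le> B + K * (B + B)" for k
  proof -
    have "xt k = x (Suc k) + (Gm \<circ> V) (\<alpha> k - \<alpha> (Suc k))"
      by (simp add: x_Suc \<alpha>_Suc)
    also have "norm \<dots> \<le> norm (x (Suc k)) + K * norm (\<alpha> k - \<alpha> (Suc k))"
      using K(2) by (intro norm_triangle_le add_left_mono)
    also have "\<dots> \<le> norm (u (Suc k)) + K * (norm (u k) + norm (u (Suc k)))"
      using K(1) norm_fst_le[of "x (Suc k)" "\<alpha> (Suc k)"] norm_snd_le[of "\<alpha> k" "x k"]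
        norm_snd_le[of "\<alpha> (Suc k)" "x (Suc k)"]
      by (intro add_mono mult_left_mono order_trans[OF norm_triangle_ineq4]) auto
    also have "\<dots> \<le> B + K * (B + B)"
      using K(1) B by (intro add_mono mult_left_mono) auto
    finally show ?thesis .
  qed
  then show ?thesis
    by (rule that)
qed

abbreviation "X \<equiv> average (fst \<circ> ut)"
abbreviation "\<Lambda> \<equiv> average (snd \<circ> ut)"

lemma G_X_le:
  assumes "1 \<le> K"
  shows "G (X K) \<le> ereal ((\<Sum>k<K. Gr (xt k)) / real K)"
  using assms by (intro convex_epi_average G_convex) (auto simp: G_real[OF G_xt])

lemma Gr_X_le:
  assumes "1 \<le> K"
  shows "G (X K) \<noteq> \<infinity>" "real K * Gr (X K) \<le> (\<Sum>k<K. Gr (xt k))"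
proof -
  show fin: "G (X K) \<noteq> \<infinity>"
    using G_X_le[OF assms] by auto
  show "real K * Gr (X K) \<le> (\<Sum>k<K. Gr (xt k))"
    using G_X_le[OF assms] assms by (simp add: G_real[OF fin] field_simps)
qed

lemma F_X_le:
  assumes "1 \<le> K"
  shows "real K * F (X K) \<le> (\<Sum>k<K. F (xt k))"
proof -
  have "(\<Sum>k<K. F (X K) + grad F (X K) \<bullet> (xt k - X K)) \<le> (\<Sum>k<K. F (xt k))"
    by (intro sum_mono F_ge_tangent)
  moreover have "(\<Sum>k<K. grad F (X K) \<bullet> (xt k - X K)) = grad F (X K) \<bullet> ((\<Sum>k<K. xt k) - real K *\<^sub>R X K)"
    by (simp only: inner_sum_right[symmetric] sum_subtractf sum_constant_scaleR card_lessThan)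
  moreover have "(\<Sum>k<K. xt k) = real K *\<^sub>R X K"
    using sum_eq_average[OF assms, of "fst \<circ> ut"] by simp
  ultimately show ?thesis
    by (simp add: sum.distrib)
qed

lemma primal_dual_gap:
  assumes "\<And>i. \<tau> i < 1 / L i" "G z \<noteq> \<infinity>"
  shows "\<exists>C. \<forall>K\<ge>1. (F (X K) + Gr (X K) - w \<bullet> V (X K)) - (F z + Gr z - \<Lambda> K \<bullet> V z) \<le> C / real K"
proof -
  obtain R where R: "\<And>k. norm (xt k) \<le> R"
    using xt_bounded by metis
  define D where "D = suminf (\<lambda>k. norm (d k))"
  define C where "C = \<Phi> 0 z w / 2 + D * (R + norm z)"
  define gap where "gap = (\<lambda>k. (F (xt k) + Gr (xt k) - w \<bullet> V (xt k)) - (F z + Gr z - \<alpha>t k \<bullet> V z))"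
  have "0 \<le> R"
    using R[of 0] norm_ge_zero order_trans by blast
  have "(F (X K) + Gr (X K) - w \<bullet> V (X K)) - (F z + Gr z - \<Lambda> K \<bullet> V z) \<le> C / real K" if K: "1 \<le> K" for K
  proof -
    have step: "gap k \<le> (\<Phi> k z w - \<Phi> (Suc k) z w) / 2 + norm (d k) * (R + norm z)" for k
    proof -
      have "d k \<bullet> (xt k - z) \<le> norm (d k) * norm (xt k - z)"
        by (rule norm_cauchy_schwarz)
      also have "\<dots> \<le> norm (d k) * (R + norm z)"
        using R[of k] by (intro mult_left_mono order_trans[OF norm_triangle_ineq4]) auto
      finally show ?thesis
        using gap_step[OF assms, of k w] unfolding gap_def by argo
    qed
    have "(\<Sum>k<K. gap k) \<le> (\<Sum>k<K. (\<Phi> k z w - \<Phi> (Suc k) z w) / 2 + norm (d k) * (R + norm z))"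
      by (intro sum_mono step)
    also have "\<dots> = (\<Phi> 0 z w - \<Phi> K z w) / 2 + (\<Sum>k<K. norm (d k)) * (R + norm z)"
      by (simp only: sum.distrib sum_divide_distrib[symmetric] sum_distrib_right
        sum_lessThan_telescope'[of "\<lambda>k. \<Phi> k z w"])
    finally have "(\<Sum>k<K. gap k) \<le> (\<Phi> 0 z w - \<Phi> K z w) / 2 + (\<Sum>k<K. norm (d k)) * (R + norm z)" .
    moreover have "(\<Sum>k<K. norm (d k)) * (R + norm z) \<le> D * (R + norm z)"
      unfolding D_def using d_summable \<open>0 \<le> R\<close> by (intro mult_right_mono sum_le_suminf) auto
    ultimately have "(\<Sum>k<K. gap k) \<le> C"
      using \<Phi>_nonneg[of K z w] unfolding C_def by argo
    moreover have "(\<Sum>k<K. gap k) = (\<Sum>k<K. F (xt k)) + (\<Sum>k<K. Gr (xt k)) - w \<bullet> V (\<Sum>k<K. xt k)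
        - (real K * (F z + Gr z) - (\<Sum>k<K. \<alpha>t k) \<bullet> V z)"
      unfolding gap_def
      by (simp add: sum_subtractf sum.distrib linear_sum[OF V_linear] inner_sum_right inner_sum_left)
    moreover have "(\<Sum>k<K. xt k) = real K *\<^sub>R X K" "(\<Sum>k<K. \<alpha>t k) = real K *\<^sub>R \<Lambda> K"
      using sum_eq_average[OF K, of "fst \<circ> ut"] sum_eq_average[OF K, of "snd \<circ> ut"] by auto
    ultimately have "real K * ((F (X K) + Gr (X K) - w \<bullet> V (X K)) - (F z + Gr z - \<Lambda> K \<bullet> V z)) \<le> C"
      using F_X_le[OF K] Gr_X_le(2)[OF K] by (simp add: V_simps algebra_simps)
    then show ?thesis
      using K by (simp add: field_simps)
  qed
  then show ?thesis
    by blast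
qed

lemma consensus_error: "\<exists>C. \<forall>K\<ge>1. norm (V (X K)) \<le> C / real K"
proof -
  obtain B where B: "\<And>k. norm (u k) \<le> B"
    using iterates_summable(1) by (auto simp: bounded_iff)
  have "norm (V (X K)) \<le> (B + B) / \<beta> / real K" if "1 \<le> K" for K
  proof -
    have "V (X K) = average (\<lambda>k. (1 / \<beta>) *\<^sub>R (\<alpha> k - \<alpha> (Suc k))) K"
      by (simp add: linear_average[OF V_linear] o_def V_xt \<alpha>_Suc)
    also have "\<dots> = (1 / real K) *\<^sub>R (1 / \<beta>) *\<^sub>R (\<alpha> 0 - \<alpha> K)"
      by (simp only: average_def scaleR_sum_right[symmetric] sum_lessThan_telescope'[of "\<lambda>k. \<alpha> k"])
    finally have "norm (V (X K)) = norm (\<alpha> 0 - \<alpha> K) / \<beta> / real K"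
      using beta(1) by simp
    also have "norm (\<alpha> 0 - \<alpha> K) \<le> B + B"
      using B[of 0] B[of K] norm_snd_le[of "\<alpha> 0" "x 0"] norm_snd_le[of "\<alpha> K" "x K"]
        norm_triangle_ineq4[of "\<alpha> 0" "\<alpha> K"] by simp
    finally show ?thesis
      using beta(1) by (simp add: divide_right_mono)
  qed
  then show ?thesis
    by blast
qed

lemma lagrangian_real: "G z \<noteq> \<infinity> \<Longrightarrow> lagrangian f g V z w = ereal (F z + Gr z - w \<bullet> V z)"
  by (simp add: lagrangian_def G_real)

lemma lagrangian_gap:
  assumes "\<And>i. \<tau> i < 1 / L i"
  shows "\<exists>C::real. \<forall>K\<ge>1. lagrangian f g V (X K) w - lagrangian f g V z (\<Lambda> K) \<le> ereal (C / real K)"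
proof (cases "G z = \<infinity>")
  case True
  then have "lagrangian f g V (X K) w - lagrangian f g V z (\<Lambda> K) = -\<infinity>" if "1 \<le> K" for K
    using that by (simp add: lagrangian_real[OF Gr_X_le(1)]) (simp add: lagrangian_def)
  then show ?thesis
    by auto
next
  case False
  with primal_dual_gap[OF assms this, of w] show ?thesis
    by (auto simp: lagrangian_real Gr_X_le(1))
qed

lemma objective_gap:
  assumes "\<And>i. \<tau> i < 1 / L i" and opt: "is_arg_min (objective f g) (\<lambda>x. V x = 0) xo"
  shows "\<exists>C::real. \<forall>K\<ge>1. \<bar>objective f g (X K) - objective f g xo\<bar> \<le> ereal (C / real K)"
proof -
  obtain xs \<alpha>s where s: "V xs = 0" "G xs \<noteq> \<infinity>"
    "\<And>z. G z \<noteq> \<infinity> \<Longrightarrow> F xs + Gr xs \<le> F z + Gr z - \<alpha>s \<bullet> V z"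
    using saddle_point_obtain by metis
  have xo: "V xo = 0" "objective f g xo \<le> objective f g xs"
    using opt s(1) by (auto simp: is_arg_min_def not_less)
  have Gxo: "G xo \<noteq> \<infinity>"
    using xo(2) by (auto simp: objective_def G_real[OF s(2)])
  have le: "F xo + Gr xo \<le> F xs + Gr xs"
    using xo(2) by (simp add: objective_def G_real s(2) Gxo)
  obtain C1 where C1: "\<And>K. 1 \<le> K \<Longrightarrow>
      F (X K) + Gr (X K) - 0 \<bullet> V (X K) - (F xo + Gr xo - \<Lambda> K \<bullet> V xo) \<le> C1 / real K"
    using primal_dual_gap[OF assms(1) Gxo, of 0] by blast
  obtain C2 where C2: "\<And>K. 1 \<le> K \<Longrightarrow> norm (V (X K)) \<le> C2 / real K"
    using consensus_error by blast
  have "\<bar>objective f g (X K) - objective f g xo\<bar> \<le> ereal (max C1 (norm \<alpha>s * C2) / real K)"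
    if K: "1 \<le> K" for K
  proof -
    have "F (X K) + Gr (X K) - (F xo + Gr xo) \<le> max C1 (norm \<alpha>s * C2) / real K"
    proof -
      have "C1 / real K \<le> max C1 (norm \<alpha>s * C2) / real K"
        by (intro divide_right_mono) auto
      then show ?thesis
        using C1[OF K] xo(1) by simp
    qed
    moreover have "- (F (X K) + Gr (X K) - (F xo + Gr xo)) \<le> max C1 (norm \<alpha>s * C2) / real K"
    proof -
      have "- (\<alpha>s \<bullet> V (X K)) \<le> norm \<alpha>s * norm (V (X K))"
        using norm_cauchy_schwarz[of "- \<alpha>s" "V (X K)"] by simp
      also have "\<dots> \<le> norm \<alpha>s * (C2 / real K)"
        using C2[OF K] by (rule mult_left_mono) simp
      also have "\<dots> \<le> max C1 (norm \<alpha>s * C2) / real K"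
        by (simp add: divide_right_mono)
      finally show ?thesis
        using s(3)[OF Gr_X_le(1)[OF K]] le by linarith
    qed
    ultimately show ?thesis
      by (simp add: objective_def G_real Gxo Gr_X_le(1)[OF K] abs_le_iff)
  qed
  then show ?thesis
    by blast
qed

end

theorem theorem2:
  fixes f :: "'a::finite \<Rightarrow> real ^ 'n \<Rightarrow> real"
    and g :: "'a \<Rightarrow> real ^ 'n \<Rightarrow> ereal"
    and L \<tau> :: "'a \<Rightarrow> real"
    and E :: "('a \<times> 'a) set"
    and W :: "real ^ 'a ^ 'a"
    and V :: "real ^ 'n ^ 'a \<Rightarrow> real ^ 'n ^ 'a"
    and \<beta> :: real
    and \<epsilon> :: "nat \<Rightarrow> real"
    and d :: "nat \<Rightarrow> real ^ 'n ^ 'a"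
    and u ut :: "nat \<Rightarrow> (real ^ 'n ^ 'a) \<times> (real ^ 'n ^ 'a)"
  assumes f_convex: "\<And>i. convex_on UNIV (f i)"
    and L_pos: "\<And>i. 0 < L i"
    and f_smooth: "\<And>i. L_smooth (L i) (f i)"
    and g_pcc: "\<And>i. proper_closed_convex (g i)"
    and optimal_exists:
      "\<exists>xo. is_arg_min (\<lambda>x. \<Sum>i\<in>UNIV. ereal (f i x) + g i x) (\<lambda>_. True) xo"
    and undirected: "sym E"
    and connected_graph: "\<And>i j. (i, j) \<in> E\<^sup>*"
    and W_mixing: "mixing_matrix E W"
    and V_sqrt: "psd_sqrt (\<lambda>x. x - kron_id W x) V"
    and strong_duality: "saddle_points f g V \<noteq> {}"
    and eps_nonneg: "\<And>k. 0 \<le> \<epsilon> k"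
    and d_bound: "\<And>k i. norm (d k $ i) \<le> \<epsilon> k"
    and iterates: "D_iPGM f g V \<tau> \<beta> d u ut"
    and tau: "\<And>i. 0 < \<tau> i \<and> \<tau> i < 2 / L i"
    and beta: "0 < \<beta>" "\<beta> \<le> 0.5 / Max (range \<tau>)"
    and eps_summable: "summable (\<lambda>k. \<epsilon> (Suc k))"
  shows
    "(\<lambda>K. 1 / real (K + 1) * (\<Sum>k=0..K. (kkt_dist f g V (ut k))\<^sup>2)) \<in> O(\<lambda>K. 1 / real (K + 1)) \<and>
     (\<lambda>K. Min ((\<lambda>k. (kkt_dist f g V (ut k))\<^sup>2) ` {0..K})) \<in> o(\<lambda>K. 1 / real (K + 1)) \<and>
     ((\<forall>i. \<tau> i < 1 / L i) \<longrightarrow>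
        (\<forall>x \<alpha>. \<exists>C::real. \<forall>K\<ge>1.
           lagrangian f g V (average (fst \<circ> ut) K) \<alpha> - lagrangian f g V x (average (snd \<circ> ut) K)
             \<le> ereal (C / real K)) \<and>
        (\<forall>xs. is_arg_min (objective f g) (\<lambda>x. V x = 0) xs \<longrightarrow>
           (\<exists>C::real. \<forall>\<^sub>F K in sequentially.
              \<bar>objective f g (average (fst \<circ> ut) K) - objective f g xs\<bar> \<le> ereal (C / real K))) \<and>
        (\<lambda>K. norm (V (average (fst \<circ> ut) K))) \<in> O(\<lambda>K. 1 / real K))"
proof -
  interpret d_ipgm f g L \<tau> E W V \<beta> \<epsilon> d u ut
    by unfold_locales fact+
  show ?thesis
  proof (intro conjI impI allI)
    show "(\<lambda>K. 1 / real (K + 1) * (\<Sum>k=0..K. (kkt_dist f g V (ut k))\<^sup>2)) \<in> O(\<lambda>K. 1 / real (K + 1))"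
      by (intro summable_average_bigo kkt_dist_square_summable) simp
    show "(\<lambda>K. Min ((\<lambda>k. (kkt_dist f g V (ut k))\<^sup>2) ` {0..K})) \<in> o(\<lambda>K. 1 / real (K + 1))"
      by (intro summable_Min_smallo kkt_dist_square_summable) simp
  next
    fix x \<alpha> assume "\<forall>i. \<tau> i < 1 / L i"
    then show "\<exists>C::real. \<forall>K\<ge>1.
        lagrangian f g V (average (fst \<circ> ut) K) \<alpha> - lagrangian f g V x (average (snd \<circ> ut) K)
          \<le> ereal (C / real K)"
      by (intro lagrangian_gap) simp
  next
    fix xs assume "\<forall>i. \<tau> i < 1 / L i" "is_arg_min (objective f g) (\<lambda>x. V x = 0) xs"
    then obtain C :: real where "\<forall>K\<ge>1.
        \<bar>objective f g (average (fst \<circ> ut) K) - objective f g xs\<bar> \<le> ereal (C / real K)"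
      using objective_gap by blast
    then show "\<exists>C::real. \<forall>\<^sub>F K in sequentially.
        \<bar>objective f g (average (fst \<circ> ut) K) - objective f g xs\<bar> \<le> ereal (C / real K)"
      unfolding eventually_sequentially by blast
  next
    obtain C where "\<forall>K\<ge>1. norm (V (average (fst \<circ> ut) K)) \<le> C / real K"
      using consensus_error by blast
    then have "\<forall>\<^sub>F K in sequentially. norm (norm (V (average (fst \<circ> ut) K))) \<le> C * norm (1 / real K)"
      by (auto simp: eventually_sequentially)
    then show "(\<lambda>K. norm (V (average (fst \<circ> ut) K))) \<in> O(\<lambda>K. 1 / real K)"
      by (rule bigoI)
  qed
qed

end
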